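(* Let $x\in X$ be such that $\mathfrak a(x)\ne \mathrm{cl}(x)$. Let $q=|\mathrm{cl}(x)\cup [x]|$ and $p=|[x]|$. Then $p\le q$ and $\mathrm{St}_x^{\mathrm v}$ has subgroups $\mathrm{St}_{x,l}^{\mathrm v}$ and $\mathrm{St}_{x,s}^{\mathrm v}$ such that $$\mathrm{St}_x^{\mathrm v}=\mathrm{St}_{x,l}^{\mathrm v}\ltimes \mathrm{St}_{x,s}^{\mathrm v},$$ $$\mathrm{St}_{x,l}^{\mathrm v}=\{\phi\in \mathrm{St}_x^{\mathrm v}: y\phi\in \mathbb G([x]\cup \mathfrak a_{\mathrm{out}}(x))\text{ for all }y\in [x]\}$$ and $$\mathrm{St}_{x,s}^{\mathrm v}\cong \mathcal M(p,q-p).$$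
   Context: Let $\Gamma$ be a finite simple graph with vertex set $X$, and let $\mathbb G=\mathbb G_\Gamma$ be the partially commutative group (right-angled Artin group) generated by $X$ with relations $[x,y]=1$ for each edge $\{x,y\}$ of $\Gamma$. For $Y\subseteq X$, $\mathbb G(Y)$ is the subgroup generated by $Y$. Automorphisms act on the right. For $x\in X$: $\mathrm{lk}(x)$ is the set of vertices adjacent to $x$, $\mathrm{st}(x)=\mathrm{lk}(x)\cup\{x\}$. Write $x\sim y$ if $\mathrm{st}(x)=\mathrm{st}(y)$ or $\mathrm{lk}(x)=\mathrm{lk}(y)$; this is an equivalence relation with classes $[x]$. Put $\mathfrak a(x)=\bigcap_{y\in \mathrm{lk}(x)}\mathrm{st}(y)$ (equal to $X$ if $\mathrm{lk}(x)=\emptyset$), $\mathrm{cl}(x)=\bigcap_{y\in \mathrm{st}(x)}\mathrm{st}(y)$, $\mathfrak a_{\mathrm{out}}(x)=\mathfrak a(x)\setminus(\mathrm{cl}(x)\cup [x])$, and $\mathcal K=\{\mathfrak a(x): x\in X\}$. Define $\mathrm{St}(\mathcal K)=\{\phi\in\mathrm{Aut}(\mathbb G): \mathbb G(Y)\phi=\mathbb G(Y)\text{ for all }Y\in\mathcal K\}$ and $\mathrm{St}_x^{\mathrm v}=\{\phi\in \mathrm{St}(\mathcal K): y\phi=y\ \forall y\in X\setminus [x]\}$. $\mathcal M(a,b)$ is the additive group of $a\times b$ integer matrices (trivial if $b=0$). In $H\ltimes N$ the (internal) normal factor is $N$. *)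

theory Defs
  imports
    "HOL-Algebra.Bij"
    "HOL-Algebra.Generated_Groups"
    "Graph_Theory.Pair_Digraph"
    "Jordan_Normal_Form.Matrix"
begin

section \<open>Groups given by generators and relators\<close>

text \<open>The letter \<open>(x, True)\<close> stands for \<open>x\<close> and \<open>(x, False)\<close> for its formal inverse.\<close>

type_synonym 'a gword = "('a \<times> bool) list"

definition words :: "'a set \<Rightarrow> 'a gword set" where
  "words X = lists (X \<times> UNIV)"

definition word_inv :: "'a gword \<Rightarrow> 'a gword" where
  "word_inv w = rev (map (\<lambda>(x, b). (x, \<not> b)) w)"

text \<open>Two words are identified iff one is obtained from the other by inserting and deleting
  finitely many relators and finitely many factors of the form \<open>x x\<^sup>-\<^sup>1\<close> or \<open>x\<^sup>-\<^sup>1 x\<close>.\<close>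

inductive_set pres_rel :: "'a set \<Rightarrow> 'a gword set \<Rightarrow> ('a gword \<times> 'a gword) set"
  for X R where
  refl: "w \<in> words X \<Longrightarrow> (w, w) \<in> pres_rel X R"
| sym: "(u, v) \<in> pres_rel X R \<Longrightarrow> (v, u) \<in> pres_rel X R"
| trans: "(u, v) \<in> pres_rel X R \<Longrightarrow> (v, w) \<in> pres_rel X R \<Longrightarrow> (u, w) \<in> pres_rel X R"
| cancel: "u \<in> words X \<Longrightarrow> v \<in> words X \<Longrightarrow> x \<in> X \<Longrightarrow>
    (u @ [(x, b), (x, \<not> b)] @ v, u @ v) \<in> pres_rel X R"
| relator: "u \<in> words X \<Longrightarrow> v \<in> words X \<Longrightarrow> r \<in> R \<Longrightarrow> (u @ r @ v, u @ v) \<in> pres_rel X R"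

definition presented_group :: "'a set \<Rightarrow> 'a gword set \<Rightarrow> 'a gword set monoid" where
  "presented_group X R =
    \<lparr>carrier = words X // pres_rel X R,
     monoid.mult = \<lambda>A B. \<Union>u\<in>A. \<Union>v\<in>B. pres_rel X R `` {u @ v},
     one = pres_rel X R `` {[]}\<rparr>"

lemma words_append_iff [simp]: "u @ v \<in> words X \<longleftrightarrow> u \<in> words X \<and> v \<in> words X"
  by (auto simp: words_def)

lemma words_Nil [simp]: "[] \<in> words X"
  by (simp add: words_def)

lemma words_Cons [simp]: "a # w \<in> words X \<longleftrightarrow> fst a \<in> X \<and> w \<in> words X"
  by (cases a) (auto simp: words_def)

lemma word_inv_words [simp]: "w \<in> words X \<Longrightarrow> word_inv w \<in> words X"
  by (auto simp: words_def word_inv_def)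

lemma pres_rel_words:
  assumes "R \<subseteq> words X" "(u, v) \<in> pres_rel X R"
  shows "u \<in> words X \<and> v \<in> words X"
  using assms(2) by induction (use assms(1) in auto)

lemma equiv_pres_rel:
  assumes "R \<subseteq> words X"
  shows "equiv (words X) (pres_rel X R)"
proof (rule equivI)
  show "pres_rel X R \<subseteq> words X \<times> words X"
    using pres_rel_words[OF assms] by auto
  show "refl_on (words X) (pres_rel X R)"
    by (auto simp: refl_on_def intro: pres_rel.refl)
  show "sym (pres_rel X R)"
    by (auto simp: sym_def intro: pres_rel.sym)
  show "trans (pres_rel X R)"
    by (auto simp: trans_def intro: pres_rel.trans)
qed

lemma pres_rel_context:
  assumes "(u, v) \<in> pres_rel X R" "a \<in> words X" "b \<in> words X"
  shows "(a @ u @ b, a @ v @ b) \<in> pres_rel X R"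
  using assms(1)
proof induction
  case (refl w)
  then show ?case using assms by (auto intro: pres_rel.refl)
next
  case (sym u v)
  then show ?case by (auto intro: pres_rel.sym)
next
  case (trans u v w)
  then show ?case by (blast intro: pres_rel.trans)
next
  case (cancel u v x c)
  then show ?case using assms pres_rel.cancel[of "a @ u" X "v @ b" x c R] by simp
next
  case (relator u v r)
  then show ?case using assms pres_rel.relator[of "a @ u" X "v @ b" r R] by simp
qed

lemma pres_rel_append:
  assumes R: "R \<subseteq> words X" and u: "(u, u') \<in> pres_rel X R" and v: "(v, v') \<in> pres_rel X R"
  shows "(u @ v, u' @ v') \<in> pres_rel X R"
proof -
  have "(u @ v, u' @ v) \<in> pres_rel X R"
    using pres_rel_context[OF u, of "[]" v] pres_rel_words[OF R v] by simp
  moreover have "(u' @ v, u' @ v') \<in> pres_rel X R"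
    using pres_rel_context[OF v, of u' "[]"] pres_rel_words[OF R u] by simp
  ultimately show ?thesis by (rule pres_rel.trans)
qed

lemma pres_rel_inv:
  assumes "w \<in> words X"
  shows "(word_inv w @ w, []) \<in> pres_rel X R"
  using assms
proof (induction w)
  case Nil
  then show ?case by (auto simp: word_inv_def intro: pres_rel.refl)
next
  case (Cons a w)
  obtain x c where a: "a = (x, c)" by (cases a)
  have "(word_inv w @ [(x, \<not> c), (x, \<not> \<not> c)] @ w, word_inv w @ w) \<in> pres_rel X R"
    by (rule pres_rel.cancel) (use Cons.prems a in auto)
  then show ?case
    using Cons a by (auto simp: word_inv_def intro: pres_rel.trans)
qed

lemma presented_group_mult:
  assumes R: "R \<subseteq> words X" and "u \<in> words X" "v \<in> words X"
  shows "(pres_rel X R `` {u}) \<otimes>\<^bsub>presented_group X R\<^esub> (pres_rel X R `` {v})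
    = pres_rel X R `` {u @ v}"
proof -
  have eq: "pres_rel X R `` {u' @ v'} = pres_rel X R `` {u @ v}"
    if "u' \<in> pres_rel X R `` {u}" "v' \<in> pres_rel X R `` {v}" for u' v'
    using equiv_class_eq[OF equiv_pres_rel[OF R] pres_rel_append[OF R, of u u' v v']] that
    by simp
  have ne: "u \<in> pres_rel X R `` {u}" "v \<in> pres_rel X R `` {v}"
    using assms(2,3) by (simp_all add: pres_rel.refl)
  have "(\<Union>u'\<in>pres_rel X R `` {u}. \<Union>v'\<in>pres_rel X R `` {v}. pres_rel X R `` {u' @ v'})
      = (\<Union>u'\<in>pres_rel X R `` {u}. \<Union>v'\<in>pres_rel X R `` {v}. pres_rel X R `` {u @ v})"
    by (intro SUP_cong HOL.refl eq)
  also have "\<dots> = pres_rel X R `` {u @ v}"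
    using ne by blast
  finally show ?thesis
    by (simp add: presented_group_def)
qed

lemma presented_group_carrierE:
  assumes "A \<in> carrier (presented_group X R)"
  obtains u where "u \<in> words X" "A = pres_rel X R `` {u}"
  using assms by (auto simp: presented_group_def elim: quotientE)

lemma presented_group_class_carrier:
  "u \<in> words X \<Longrightarrow> pres_rel X R `` {u} \<in> carrier (presented_group X R)"
  by (simp add: presented_group_def quotientI)

lemma group_presented_group:
  assumes R: "R \<subseteq> words X"
  shows "group (presented_group X R)"
proof (rule groupI)
  have one: "\<one>\<^bsub>presented_group X R\<^esub> = pres_rel X R `` {[]}"
    by (simp add: presented_group_def)
  show "\<one>\<^bsub>presented_group X R\<^esub> \<in> carrier (presented_group X R)"
    by (simp add: one presented_group_class_carrier)
  fix A assume "A \<in> carrier (presented_group X R)"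
  then obtain u where u: "u \<in> words X" "A = pres_rel X R `` {u}"
    by (rule presented_group_carrierE)
  show "\<one>\<^bsub>presented_group X R\<^esub> \<otimes>\<^bsub>presented_group X R\<^esub> A = A"
    using presented_group_mult[OF R, of "[]" u] u by (simp add: one)
  have "pres_rel X R `` {word_inv u @ u} = pres_rel X R `` {[]}"
    by (rule equiv_class_eq[OF equiv_pres_rel[OF R] pres_rel_inv[OF u(1)]])
  then show "\<exists>B\<in>carrier (presented_group X R).
      B \<otimes>\<^bsub>presented_group X R\<^esub> A = \<one>\<^bsub>presented_group X R\<^esub>"
    using u presented_group_mult[OF R, of "word_inv u" u]
    by (intro bexI[of _ "pres_rel X R `` {word_inv u}"])
      (auto simp: one presented_group_class_carrier)
  fix B assume "B \<in> carrier (presented_group X R)"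
  then obtain v where v: "v \<in> words X" "B = pres_rel X R `` {v}"
    by (rule presented_group_carrierE)
  show "A \<otimes>\<^bsub>presented_group X R\<^esub> B \<in> carrier (presented_group X R)"
    using u v by (simp add: presented_group_mult[OF R] presented_group_class_carrier)
  fix C assume "C \<in> carrier (presented_group X R)"
  then obtain w where w: "w \<in> words X" "C = pres_rel X R `` {w}"
    by (rule presented_group_carrierE)
  show "A \<otimes>\<^bsub>presented_group X R\<^esub> B \<otimes>\<^bsub>presented_group X R\<^esub> C
      = A \<otimes>\<^bsub>presented_group X R\<^esub> (B \<otimes>\<^bsub>presented_group X R\<^esub> C)"
    using u v w by (simp add: presented_group_mult[OF R])
qed


section \<open>Partially commutative groups\<close>

text \<open>A finite simple graph is a \<^locale>\<open>pair_graph\<close>: an edge \<open>{x, y}\<close> is represented by the two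
  arcs \<open>(x, y)\<close> and \<open>(y, x)\<close>.\<close>

definition commutator_word :: "'a \<Rightarrow> 'a \<Rightarrow> 'a gword" where
  "commutator_word x y = [(x, False), (y, False), (x, True), (y, True)]"

definition pc_group :: "'a pair_pre_digraph \<Rightarrow> 'a gword set monoid" where
  "pc_group \<Gamma> = presented_group (pverts \<Gamma>) {commutator_word x y | x y. (x, y) \<in> parcs \<Gamma>}"

definition pc_gen :: "'a pair_pre_digraph \<Rightarrow> 'a \<Rightarrow> 'a gword set" where
  "pc_gen \<Gamma> x =
    pres_rel (pverts \<Gamma>) {commutator_word x y | x y. (x, y) \<in> parcs \<Gamma>} `` {[(x, True)]}"

definition pc_sub :: "'a pair_pre_digraph \<Rightarrow> 'a set \<Rightarrow> 'a gword set set" where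
  "pc_sub \<Gamma> Y = generate (pc_group \<Gamma>) (pc_gen \<Gamma> ` Y)"

lemma group_pc_group:
  assumes "pair_graph \<Gamma>"
  shows "group (pc_group \<Gamma>)"
proof -
  interpret pair_graph \<Gamma> by fact
  show ?thesis
    unfolding pc_group_def
    by (rule group_presented_group)
      (auto simp: commutator_word_def dest: in_arcsD1 in_arcsD2)
qed

lemma pc_gen_carrier: "x \<in> pverts \<Gamma> \<Longrightarrow> pc_gen \<Gamma> x \<in> carrier (pc_group \<Gamma>)"
  by (simp add: pc_gen_def pc_group_def presented_group_class_carrier)


section \<open>Links, stars and admissible sets\<close>

definition lk :: "'a pair_pre_digraph \<Rightarrow> 'a \<Rightarrow> 'a set" where
  "lk \<Gamma> x = {y. (x, y) \<in> parcs \<Gamma>}"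

definition st :: "'a pair_pre_digraph \<Rightarrow> 'a \<Rightarrow> 'a set" where
  "st \<Gamma> x = lk \<Gamma> x \<union> {x}"

definition vclass :: "'a pair_pre_digraph \<Rightarrow> 'a \<Rightarrow> 'a set" where
  "vclass \<Gamma> x = {y \<in> pverts \<Gamma>. st \<Gamma> x = st \<Gamma> y \<or> lk \<Gamma> x = lk \<Gamma> y}"

text \<open>Intersecting with the vertex set yields the convention that the set is the whole vertex set
  if the link is empty; otherwise it has no effect.\<close>

definition adm :: "'a pair_pre_digraph \<Rightarrow> 'a \<Rightarrow> 'a set" where
  "adm \<Gamma> x = pverts \<Gamma> \<inter> (\<Inter>y \<in> lk \<Gamma> x. st \<Gamma> y)"

definition cl :: "'a pair_pre_digraph \<Rightarrow> 'a \<Rightarrow> 'a set" where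
  "cl \<Gamma> x = (\<Inter>y \<in> st \<Gamma> x. st \<Gamma> y)"

definition adm_out :: "'a pair_pre_digraph \<Rightarrow> 'a \<Rightarrow> 'a set" where
  "adm_out \<Gamma> x = adm \<Gamma> x - (cl \<Gamma> x \<union> vclass \<Gamma> x)"

definition adm_sets :: "'a pair_pre_digraph \<Rightarrow> 'a set set" where
  "adm_sets \<Gamma> = adm \<Gamma> ` pverts \<Gamma>"


section \<open>Groups of automorphisms\<close>

text \<open>The product in \<^const>\<open>AutoGroup\<close> is composition of functions acting on the left, so these are
  the opposites of the groups of automorphisms acting on the right. Subgroups, normal subgroups,
  internal semidirect products and isomorphism with a commutative group are the same for both.\<close>

definition StK :: "'a pair_pre_digraph \<Rightarrow> ('a gword set \<Rightarrow> 'a gword set) set" where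
  "StK \<Gamma> = {\<phi> \<in> carrier (AutoGroup (pc_group \<Gamma>)).
    \<forall>Y \<in> adm_sets \<Gamma>. \<phi> ` pc_sub \<Gamma> Y = pc_sub \<Gamma> Y}"

definition Stv :: "'a pair_pre_digraph \<Rightarrow> 'a \<Rightarrow> ('a gword set \<Rightarrow> 'a gword set) set" where
  "Stv \<Gamma> x = {\<phi> \<in> StK \<Gamma>. \<forall>y \<in> pverts \<Gamma> - vclass \<Gamma> x. \<phi> (pc_gen \<Gamma> y) = pc_gen \<Gamma> y}"

definition Stv_group :: "'a pair_pre_digraph \<Rightarrow> 'a \<Rightarrow> ('a gword set \<Rightarrow> 'a gword set) monoid" where
  "Stv_group \<Gamma> x = AutoGroup (pc_group \<Gamma>) \<lparr>carrier := Stv \<Gamma> x\<rparr>"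

definition internal_semidirect :: "('b, 'c) monoid_scheme \<Rightarrow> 'b set \<Rightarrow> 'b set \<Rightarrow> bool" where
  "internal_semidirect G H N \<longleftrightarrow>
    subgroup H G \<and> N \<lhd> G \<and> H \<inter> N = {\<one>\<^bsub>G\<^esub>} \<and> H <#>\<^bsub>G\<^esub> N = carrier G"

end

(* If adm x and cl x differ, then some vertex of adm x is not adjacent to x, so all vertices of the
   class K of x have the same link and the same adm. The set C = cl x - K is a clique lying in lk x
   and is central in G(adm x) = G(K u adm_out x) x G(C), and every element of the group Stv fixes
   G(C) pointwise. The normal factor consists of the maps y |-> y c_y (y in K) with c_y in G(C): it
   is normal because its elements multiply every g in G(adm x) by an element of G(C), and the
   exponent sums of the c_y are the matrix entries. Splitting y phi = l_y c_y and cancelling c_y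
   with such a map puts phi into the complement. Exponent sums, which exist by the universal
   property of the presentation, also show that the two direct factors meet trivially, so no
   normal form theorem is needed. *)
theory Submission
  imports Defs "HOL-Algebra.Elementary_Groups"
begin

text \<open>Membership in \<open>Stv_l\<close> or \<open>Stv_s\<close> constrains only the images of
  the generators in \<open>K\<close>, so each group law must first be lifted to a larger subgroup.
  For \<open>Stv_s\<close> the lift goes to \<open>sub A\<close>: conjugating by \<phi> requires the
  value at \<phi>^-1 y, of which only membership in \<open>sub A\<close> is known. For
  \<open>Stv_l\<close> the obstacle is the inverse: \<phi> maps \<open>sub U\<close> into itself,
  and that \<phi>^-1 does so too is forced by the trivial intersection of \<open>sub U\<close> and
  \<open>sub C\<close>, together with the fact that \<phi> fixes \<open>sub C\<close>. The maps y
  |-> y c_y must also be shown to exist and to preserve every \<open>sub (adm \<Gamma> u)\<close>,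
  not only \<open>sub A\<close>. Both points are statements about the graph: \<open>C\<close> is
  compatible with all neighbours of \<open>K\<close>, and it is contained in every admissible set
  that meets \<open>K\<close>.\<close>

section \<open>Generated subgroups and automorphisms\<close>

context group
begin

lemma generate_commute_elem:
  assumes A: "A \<subseteq> carrier G" and c: "c \<in> carrier G"
    and comm: "\<And>a. a \<in> A \<Longrightarrow> a \<otimes> c = c \<otimes> a" and g: "g \<in> generate G A"
  shows "g \<otimes> c = c \<otimes> g"
  using g
proof induction
  case one
  then show ?case using c by simp
next
  case (incl h)
  then show ?case by (rule comm)
next
  case (inv h)
  then have h: "h \<in> carrier G" using A by auto
  have "inv h \<otimes> (c \<otimes> h) = c"
    unfolding comm[OF inv, symmetric] using h c by (simp flip: m_assoc)
  then have "c \<otimes> inv h = inv h \<otimes> (c \<otimes> h) \<otimes> inv h" by simp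
  also have "\<dots> = inv h \<otimes> c" using h c by (simp add: m_assoc)
  finally show ?case by simp
next
  case (eng h k)
  have hk: "h \<in> carrier G" "k \<in> carrier G" using eng A generate_in_carrier by auto
  have "h \<otimes> k \<otimes> c = h \<otimes> (c \<otimes> k)" using hk c eng by (simp add: m_assoc)
  also have "\<dots> = c \<otimes> (h \<otimes> k)" using hk c eng by (simp flip: m_assoc)
  finally show ?case .
qed

text \<open>The one-element version is used twice: each \<open>a\<close> in \<open>A\<close>
  commutes with all of \<open>generate G B\<close>, so \<open>h\<close> commutes with the generators
  of the left-hand subgroup and then with \<open>g\<close>.\<close>

lemma generate_commute:
  assumes "A \<subseteq> carrier G" "B \<subseteq> carrier G"
    and comm: "\<And>a b. a \<in> A \<Longrightarrow> b \<in> B \<Longrightarrow> a \<otimes> b = b \<otimes> a"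
    and "g \<in> generate G A" "h \<in> generate G B"
  shows "g \<otimes> h = h \<otimes> g"
proof (rule generate_commute_elem[OF assms(1) _ _ assms(4)])
  show "h \<in> carrier G" using assms generate_in_carrier by blast
  fix a assume a: "a \<in> A"
  have "h \<otimes> a = a \<otimes> h"
  proof (rule generate_commute_elem[OF assms(2) _ _ assms(5)])
    show "a \<in> carrier G" using a assms(1) by auto
    show "b \<otimes> a = a \<otimes> b" if "b \<in> B" for b using comm[OF a that] by simp
  qed
  then show "a \<otimes> h = h \<otimes> a" by simp
qed

text \<open>Such products are closed under multiplication because the two inner factors can be
  exchanged. Only existence of the splitting is claimed; the two subgroups may intersect.\<close>

lemma generate_Un_commuting:
  assumes A: "A \<subseteq> carrier G" and B: "B \<subseteq> carrier G"
    and comm: "\<And>a b. a \<in> A \<Longrightarrow> b \<in> B \<Longrightarrow> a \<otimes> b = b \<otimes> a"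
    and g: "g \<in> generate G (A \<union> B)"
  shows "\<exists>a \<in> generate G A. \<exists>b \<in> generate G B. g = a \<otimes> b"
  using g
proof induction
  case one
  then show ?case by (intro bexI[of _ "\<one>"]) (auto intro: generate.one)
next
  case (incl h)
  then show ?case
  proof
    assume "h \<in> A"
    then show ?thesis
      using A by (intro bexI[of _ h] bexI[of _ "\<one>"]) (auto intro: generate.intros)
  next
    assume "h \<in> B"
    then show ?thesis
      using B by (intro bexI[of _ "\<one>"] bexI[of _ h]) (auto intro: generate.intros)
  qed
next
  case (inv h)
  then show ?case
  proof
    assume "h \<in> A"
    then show ?thesis
      using A by (intro bexI[of _ "inv h"] bexI[of _ "\<one>"]) (auto intro: generate.intros)
  next
    assume "h \<in> B"
    then show ?thesis
      using B by (intro bexI[of _ "\<one>"] bexI[of _ "inv h"]) (auto intro: generate.intros)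
  qed
next
  case (eng h k)
  then obtain a b a' b' where
    ab: "a \<in> generate G A" "b \<in> generate G B" "h = a \<otimes> b"
      "a' \<in> generate G A" "b' \<in> generate G B" "k = a' \<otimes> b'" by auto
  then have car: "a \<in> carrier G" "b \<in> carrier G" "a' \<in> carrier G" "b' \<in> carrier G"
    using A B generate_in_carrier by auto
  have "h \<otimes> k = a \<otimes> (b \<otimes> a') \<otimes> b'"
    using car by (simp add: ab(3,6) m_assoc)
  also have "b \<otimes> a' = a' \<otimes> b" using generate_commute[OF A B comm ab(4,2)] by simp
  also have "a \<otimes> (a' \<otimes> b) \<otimes> b' = (a \<otimes> a') \<otimes> (b \<otimes> b')"
    using car by (simp add: m_assoc)
  finally have "h \<otimes> k = (a \<otimes> a') \<otimes> (b \<otimes> b')" .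
  then show ?case using ab by (auto intro: generate.eng)
qed

section \<open>Automorphisms as extensional functions under composition\<close>

lemma carrier_AutoGroup [simp]: "carrier (AutoGroup G) = auto G"
  by (simp add: AutoGroup_def)

lemma auto_hom: "\<phi> \<in> auto G \<Longrightarrow> group_hom G G \<phi>"
  using is_group by (auto simp: auto_def intro!: group_hom.intro group_hom_axioms.intro)

lemma auto_in_carrier: "\<phi> \<in> auto G \<Longrightarrow> g \<in> carrier G \<Longrightarrow> \<phi> g \<in> carrier G"
  by (auto dest: auto_hom intro: group_hom.hom_closed)

lemma auto_mult:
  "\<phi> \<in> auto G \<Longrightarrow> g \<in> carrier G \<Longrightarrow> h \<in> carrier G \<Longrightarrow> \<phi> (g \<otimes> h) = \<phi> g \<otimes> \<phi> h"
  by (auto dest: auto_hom intro: group_hom.hom_mult)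

lemma AutoGroup_mult_apply:
  "\<phi> \<in> auto G \<Longrightarrow> \<psi> \<in> auto G \<Longrightarrow> g \<in> carrier G \<Longrightarrow> (\<phi> \<otimes>\<^bsub>AutoGroup G\<^esub> \<psi>) g = \<phi> (\<psi> g)"
  by (simp add: AutoGroup_def BijGroup_def auto_def compose_def)

lemma AutoGroup_one_apply: "g \<in> carrier G \<Longrightarrow> \<one>\<^bsub>AutoGroup G\<^esub> g = g"
  by (simp add: AutoGroup_def BijGroup_def)

lemma AutoGroup_one_closed: "\<one>\<^bsub>AutoGroup G\<^esub> \<in> auto G"
  using monoid.one_closed[OF group.is_monoid[OF AutoGroup]] by simp

lemma AutoGroup_mult_closed:
  "\<phi> \<in> auto G \<Longrightarrow> \<psi> \<in> auto G \<Longrightarrow> \<phi> \<otimes>\<^bsub>AutoGroup G\<^esub> \<psi> \<in> auto G"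
  using monoid.m_closed[OF group.is_monoid[OF AutoGroup]] by simp

lemma AutoGroup_inv_closed: "\<phi> \<in> auto G \<Longrightarrow> inv\<^bsub>AutoGroup G\<^esub> \<phi> \<in> auto G"
  using group.inv_closed[OF AutoGroup] by simp

lemma AutoGroup_inv_apply:
  assumes "\<phi> \<in> auto G" "g \<in> carrier G"
  shows "(inv\<^bsub>AutoGroup G\<^esub> \<phi>) (\<phi> g) = g" "\<phi> ((inv\<^bsub>AutoGroup G\<^esub> \<phi>) g) = g"
proof -
  have "inv\<^bsub>AutoGroup G\<^esub> \<phi> \<otimes>\<^bsub>AutoGroup G\<^esub> \<phi> = \<one>\<^bsub>AutoGroup G\<^esub>"
    "\<phi> \<otimes>\<^bsub>AutoGroup G\<^esub> inv\<^bsub>AutoGroup G\<^esub> \<phi> = \<one>\<^bsub>AutoGroup G\<^esub>"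
    using assms group.l_inv[OF AutoGroup] group.r_inv[OF AutoGroup] by auto
  then show "(inv\<^bsub>AutoGroup G\<^esub> \<phi>) (\<phi> g) = g" "\<phi> ((inv\<^bsub>AutoGroup G\<^esub> \<phi>) g) = g"
    using AutoGroup_mult_apply[OF AutoGroup_inv_closed assms(1), of \<phi> g]
      AutoGroup_mult_apply[OF assms(1) AutoGroup_inv_closed, of \<phi> g]
      AutoGroup_one_apply assms by auto
qed

text \<open>Elements of \<open>auto G\<close> are extensional on the carrier, so agreement there is
  equality of functions.\<close>

lemma auto_eqI:
  assumes "\<phi> \<in> auto G" "\<psi> \<in> auto G" "\<And>g. g \<in> carrier G \<Longrightarrow> \<phi> g = \<psi> g"
  shows "\<phi> = \<psi>"
  using assms by (intro extensionalityI[of _ "carrier G"]) (auto simp: auto_def Bij_def)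

text \<open>Serves to isolate the second factor of a product when the first is already known to lie
  in the subgroup.\<close>

lemma mult_in_generate_iff:
  assumes "A \<subseteq> carrier G" "g \<in> generate G A" "h \<in> carrier G"
  shows "g \<otimes> h \<in> generate G A \<longleftrightarrow> h \<in> generate G A"
proof
  have g: "g \<in> carrier G" using assms generate_in_carrier by auto
  assume "g \<otimes> h \<in> generate G A"
  then have "inv g \<otimes> (g \<otimes> h) \<in> generate G A"
    using assms generate_m_inv_closed by (auto intro: generate.eng)
  then show "h \<in> generate G A" using g assms by (simp flip: m_assoc)
qed (use assms in \<open>auto intro: generate.eng\<close>)

end

lemma (in group_hom) generate_image_subset:
  assumes "A \<subseteq> carrier G" "subgroup K H" "h ` A \<subseteq> K"
  shows "h ` generate G A \<subseteq> K"
  using assms generate_img[of A] H.generate_subgroup_incl[of "h ` A" K] by auto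

lemma hom_eq_on_generate:
  assumes "group_hom G H \<phi>" "group_hom G H \<psi>" "A \<subseteq> carrier G"
    and eq: "\<And>a. a \<in> A \<Longrightarrow> \<phi> a = \<psi> a" and "g \<in> generate G A"
  shows "\<phi> g = \<psi> g"
proof -
  interpret p: group_hom G H \<phi> by fact
  interpret q: group_hom G H \<psi> by fact
  show ?thesis
    using assms(5)
  proof induction
    case (inv h)
    then have "h \<in> carrier G" using assms(3) by auto
    then show ?case using eq[OF inv] by simp
  next
    case (eng h1 h2)
    then have "h1 \<in> carrier G" "h2 \<in> carrier G"
      using p.G.generate_in_carrier assms(3) by auto
    then show ?case using eng by simp
  qed (use eq in auto)
qed


section \<open>The universal property of a presentation\<close>

primrec word_eval :: "('b, 'c) monoid_scheme \<Rightarrow> ('a \<Rightarrow> 'b) \<Rightarrow> 'a gword \<Rightarrow> 'b" where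
  "word_eval H f [] = \<one>\<^bsub>H\<^esub>"
| "word_eval H f (a # w) =
    (if snd a then f (fst a) else inv\<^bsub>H\<^esub> f (fst a)) \<otimes>\<^bsub>H\<^esub> word_eval H f w"

context group
begin

lemma word_eval_closed:
  "f \<in> X \<rightarrow> carrier G \<Longrightarrow> w \<in> words X \<Longrightarrow> word_eval G f w \<in> carrier G"
  by (induction w) (auto simp: Pi_iff)

lemma word_eval_append:
  assumes "f \<in> X \<rightarrow> carrier G" "u \<in> words X" "v \<in> words X"
  shows "word_eval G f (u @ v) = word_eval G f u \<otimes> word_eval G f v"
  using assms(2)
proof (induction u)
  case Nil
  then show ?case using word_eval_closed[OF assms(1,3)] by simp
next
  case (Cons a u)
  then show ?case
    using assms word_eval_closed[OF assms(1)] by (auto simp: Pi_iff m_assoc)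
qed

text \<open>Makes evaluation well defined on classes of words: a cancellation is harmless in every
  group, and a relator is harmless by \<open>rel\<close>.\<close>

lemma word_eval_pres_rel:
  assumes R: "R \<subseteq> words X" and f: "f \<in> X \<rightarrow> carrier G"
    and rel: "\<And>r. r \<in> R \<Longrightarrow> word_eval G f r = \<one>" and "(u, v) \<in> pres_rel X R"
  shows "word_eval G f u = word_eval G f v"
  using assms(4)
proof induction
  case (cancel u v x b)
  moreover have "f x \<in> carrier G" using f cancel by auto
  moreover have "word_eval G f v \<in> carrier G" using word_eval_closed[OF f] cancel by auto
  moreover have "[(x, b), (x, \<not> b)] @ v \<in> words X" using cancel by auto
  moreover have "word_eval G f ([(x, b), (x, \<not> b)] @ v) = word_eval G f v"
    using calculation by (cases b) (auto simp flip: m_assoc)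
  ultimately show ?case
    by (simp only: word_eval_append[OF f])
next
  case (relator u v r)
  moreover have "word_eval G f v \<in> carrier G" using word_eval_closed[OF f] relator by auto
  ultimately show ?case
    using R rel by (simp add: word_eval_append[OF f] subset_iff)
qed auto

end

lemma presented_group_hom_exists:
  assumes R: "R \<subseteq> words X" and "group H" and f: "f \<in> X \<rightarrow> carrier H"
    and rel: "\<And>r. r \<in> R \<Longrightarrow> word_eval H f r = \<one>\<^bsub>H\<^esub>"
  obtains \<phi> where "\<phi> \<in> hom (presented_group X R) H"
    "\<And>x. x \<in> X \<Longrightarrow> \<phi> (pres_rel X R `` {[(x, True)]}) = f x"
proof
  interpret H: group H by fact
  \<comment> \<open>Evaluation at an arbitrary representative of the class; \<open>ev\<close> shows
    that the choice does not matter.\<close>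
  let ?\<phi> = "\<lambda>A. word_eval H f (SOME u. u \<in> A)"
  have ev: "?\<phi> (pres_rel X R `` {u}) = word_eval H f u" if "u \<in> words X" for u
  proof -
    have "u \<in> pres_rel X R `` {u}" using that by (auto intro: pres_rel.refl)
    then have "(SOME v. v \<in> pres_rel X R `` {u}) \<in> pres_rel X R `` {u}" by (rule someI)
    then show ?thesis using H.word_eval_pres_rel[OF R f rel] by force
  qed
  show "?\<phi> \<in> hom (presented_group X R) H"
  proof (rule homI)
    fix A assume "A \<in> carrier (presented_group X R)"
    then obtain u where u: "u \<in> words X" "A = pres_rel X R `` {u}"
      by (rule presented_group_carrierE)
    then show "?\<phi> A \<in> carrier H" using ev H.word_eval_closed[OF f] by simp
    fix B assume "B \<in> carrier (presented_group X R)"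
    then obtain v where v: "v \<in> words X" "B = pres_rel X R `` {v}"
      by (rule presented_group_carrierE)
    show "?\<phi> (A \<otimes>\<^bsub>presented_group X R\<^esub> B) = ?\<phi> A \<otimes>\<^bsub>H\<^esub> ?\<phi> B"
      using u v presented_group_mult[OF R u(1) v(1)] ev[of "u @ v"] ev[of u] ev[of v]
        H.word_eval_append[OF f u(1) v(1)] by simp
  qed
  fix x assume "x \<in> X"
  then show "?\<phi> (pres_rel X R `` {[(x, True)]}) = f x"
    using ev[of "[(x, True)]"] f by (auto simp: Pi_iff)
qed

text \<open>Ties the formal inverse letter to the group inverse, so that words with letters of both
  signs lie in the subgroup generated by the positive letters.\<close>

lemma presented_group_inv_gen:
  assumes R: "R \<subseteq> words X" and x: "x \<in> X"
  shows "inv\<^bsub>presented_group X R\<^esub> (pres_rel X R `` {[(x, True)]}) = pres_rel X R `` {[(x, False)]}"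
proof -
  interpret group "presented_group X R" by (rule group_presented_group[OF R])
  have "([(x, False), (x, True)], []) \<in> pres_rel X R"
    using pres_rel.cancel[of "[]" X "[]" x False R] x by simp
  then have "pres_rel X R `` {[(x, False), (x, True)]} = pres_rel X R `` {[]}"
    by (rule equiv_class_eq[OF equiv_pres_rel[OF R]])
  then show ?thesis
    using x presented_group_mult[OF R, of "[(x, False)]" "[(x, True)]"]
    by (intro inv_equality presented_group_class_carrier) (auto simp: presented_group_def)
qed

lemma presented_group_generate:
  assumes R: "R \<subseteq> words X"
  shows "carrier (presented_group X R)
    = generate (presented_group X R) ((\<lambda>x. pres_rel X R `` {[(x, True)]}) ` X)"
    (is "?C = generate ?P ?A")
proof
  interpret group ?P by (rule group_presented_group[OF R])
  show "generate ?P ?A \<subseteq> ?C"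
    by (intro generate_incl) (auto intro: presented_group_class_carrier)
  have "pres_rel X R `` {w} \<in> generate ?P ?A" if "w \<in> words X" for w
    using that
  proof (induction w)
    case Nil
    have "\<one>\<^bsub>?P\<^esub> = pres_rel X R `` {[]}" by (simp add: presented_group_def)
    then show ?case using generate.one by metis
  next
    case (Cons a w)
    obtain x b where a: "a = (x, b)" by (cases a)
    have x: "x \<in> X" using Cons a by simp
    have "pres_rel X R `` {[(x, b)]} \<in> generate ?P ?A"
    proof (cases b)
      case False
      then show ?thesis
        using generate.inv[of "pres_rel X R `` {[(x, True)]}" ?A ?P] x
          presented_group_inv_gen[OF R x] by auto
    qed (use x in \<open>auto intro: generate.incl\<close>)
    moreover have "pres_rel X R `` {w} \<in> generate ?P ?A" using Cons by simp
    ultimately have "pres_rel X R `` {[(x, b)]} \<otimes>\<^bsub>?P\<^esub> pres_rel X R `` {w} \<in> generate ?P ?A"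
      by (rule generate.eng)
    then show ?case using presented_group_mult[OF R, of "[(x, b)]" w] Cons.prems a by simp
  qed
  then show "?C \<subseteq> generate ?P ?A" by (auto elim!: presented_group_carrierE)
qed


section \<open>Partially commutative groups\<close>

locale raag =
  fixes \<Gamma> :: "'a pair_pre_digraph"
  assumes graph: "pair_graph \<Gamma>"
begin

abbreviation "\<G> \<equiv> pc_group \<Gamma>"
abbreviation "gen \<equiv> pc_gen \<Gamma>"
abbreviation "sub \<equiv> pc_sub \<Gamma>"
abbreviation "V \<equiv> pverts \<Gamma>"
abbreviation "\<A> \<equiv> AutoGroup \<G>"

lemma in_arcsD1: "(u, v) \<in> parcs \<Gamma> \<Longrightarrow> u \<in> V"
  and in_arcsD2: "(u, v) \<in> parcs \<Gamma> \<Longrightarrow> v \<in> V"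
proof -
  interpret pair_graph \<Gamma> by (rule graph)
  show "(u, v) \<in> parcs \<Gamma> \<Longrightarrow> u \<in> V" "(u, v) \<in> parcs \<Gamma> \<Longrightarrow> v \<in> V"
    using arc_fst_in_verts arc_snd_in_verts by fastforce+
qed

lemma finite_verts: "finite V"
  using graph by (simp add: pair_graph_def pair_digraph_def pair_fin_digraph_def
    pair_fin_digraph_axioms_def)

lemma arc_irrefl: "(u, u) \<notin> parcs \<Gamma>"
  using graph by (auto simp: pair_graph_def pair_digraph_def pair_loopfree_digraph_def
    pair_loopfree_digraph_axioms_def)

lemma arc_sym: "(u, v) \<in> parcs \<Gamma> \<Longrightarrow> (v, u) \<in> parcs \<Gamma>"
  using graph by (auto simp: pair_graph_def pair_pseudo_graph_def pair_sym_digraph_def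
    pair_sym_digraph_axioms_def symmetric_def dest: symD)

lemma relators_words: "{commutator_word x y | x y. (x, y) \<in> parcs \<Gamma>} \<subseteq> words V"
  by (auto simp: commutator_word_def dest: in_arcsD1 in_arcsD2)

sublocale GG: group \<G>
  by (rule group_pc_group[OF graph])

lemma gen_carrier: "v \<in> V \<Longrightarrow> gen v \<in> carrier \<G>"
  by (rule pc_gen_carrier)

lemma gen_image_carrier: "Y \<subseteq> V \<Longrightarrow> gen ` Y \<subseteq> carrier \<G>"
  by (auto intro: gen_carrier)

lemma sub_subset_carrier: "Y \<subseteq> V \<Longrightarrow> sub Y \<subseteq> carrier \<G>"
  unfolding pc_sub_def by (intro GG.generate_incl gen_image_carrier)

lemma subgroup_sub: "Y \<subseteq> V \<Longrightarrow> subgroup (sub Y) \<G>"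
  unfolding pc_sub_def by (intro GG.generate_is_subgroup gen_image_carrier)

lemma gen_in_sub: "y \<in> Y \<Longrightarrow> gen y \<in> sub Y"
  unfolding pc_sub_def by (auto intro: generate.incl)

lemma sub_mono: "Y \<subseteq> Z \<Longrightarrow> sub Y \<subseteq> sub Z"
  unfolding pc_sub_def by (intro GG.mono_generate) auto

lemma carrier_eq_sub: "carrier \<G> = sub V"
  using presented_group_generate[OF relators_words]
  unfolding pc_sub_def pc_group_def pc_gen_def .

section \<open>Homomorphisms determined by their values on vertices\<close>

lemma pc_hom_exists:
  assumes "group H" and f: "\<And>v. v \<in> V \<Longrightarrow> f v \<in> carrier H"
    and comm: "\<And>u v. (u, v) \<in> parcs \<Gamma> \<Longrightarrow> f u \<otimes>\<^bsub>H\<^esub> f v = f v \<otimes>\<^bsub>H\<^esub> f u"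
  obtains \<phi> where "\<phi> \<in> hom \<G> H" "\<And>v. v \<in> V \<Longrightarrow> \<phi> (gen v) = f v"
proof -
  interpret H: group H by fact
  have rel: "word_eval H f r = \<one>\<^bsub>H\<^esub>" if r: "r \<in> {commutator_word x y | x y. (x, y) \<in> parcs \<Gamma>}" for r
  proof -
    obtain u v where uv: "r = commutator_word u v" "(u, v) \<in> parcs \<Gamma>" using r by auto
    have c: "f u \<in> carrier H" "f v \<in> carrier H"
      using f[OF in_arcsD1[OF uv(2)]] f[OF in_arcsD2[OF uv(2)]] .
    \<comment> \<open>The relator reads u^-1 v^-1 u v. Exchanging the last two factors by
      \<open>comm\<close> lets it collapse from the inside.\<close>
    have "word_eval H f r = inv\<^bsub>H\<^esub> f u \<otimes>\<^bsub>H\<^esub> (inv\<^bsub>H\<^esub> f v \<otimes>\<^bsub>H\<^esub> (f v \<otimes>\<^bsub>H\<^esub> f u))"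
      using c comm[OF uv(2)] by (simp add: uv commutator_word_def)
    also have "inv\<^bsub>H\<^esub> f v \<otimes>\<^bsub>H\<^esub> (f v \<otimes>\<^bsub>H\<^esub> f u) = f u"
      using c by (simp flip: H.m_assoc)
    also have "inv\<^bsub>H\<^esub> f u \<otimes>\<^bsub>H\<^esub> f u = \<one>\<^bsub>H\<^esub>" using c by simp
    finally show ?thesis .
  qed
  have "f \<in> V \<rightarrow> carrier H" using f by auto
  then show ?thesis
  proof (rule presented_group_hom_exists[OF relators_words \<open>group H\<close> _ rel])
    fix \<phi> :: "'a gword set \<Rightarrow> 'b"
    assume "\<phi> \<in> hom (presented_group V {commutator_word x y | x y. (x, y) \<in> parcs \<Gamma>}) H"
      "\<And>v. v \<in> V \<Longrightarrow>
        \<phi> (pres_rel V {commutator_word x y | x y. (x, y) \<in> parcs \<Gamma>} `` {[(v, True)]}) = f v"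
    then show thesis by (intro that[of \<phi>]) (auto simp: pc_group_def pc_gen_def)
  qed
qed

lemma gen_commute_arc:
  assumes uv: "(u, v) \<in> parcs \<Gamma>"
  shows "gen u \<otimes>\<^bsub>\<G>\<^esub> gen v = gen v \<otimes>\<^bsub>\<G>\<^esub> gen u"
proof -
  let ?R = "{commutator_word x y | x y. (x, y) \<in> parcs \<Gamma>}"
  define c where "c w = pres_rel V ?R `` {w}" for w
  have V: "u \<in> V" "v \<in> V" using uv in_arcsD1 in_arcsD2 by auto
  note gens = gen_carrier[OF V(1)] gen_carrier[OF V(2)]
  have inv: "inv\<^bsub>\<G>\<^esub> gen u = c [(u, False)]" "inv\<^bsub>\<G>\<^esub> gen v = c [(v, False)]"
    using presented_group_inv_gen[OF relators_words] V by (auto simp: pc_group_def pc_gen_def c_def)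
  have mult: "c a \<otimes>\<^bsub>\<G>\<^esub> c b = c (a @ b)" if "a \<in> words V" "b \<in> words V" for a b
    using presented_group_mult[OF relators_words that] by (simp add: pc_group_def c_def)
  have "(commutator_word u v, []) \<in> pres_rel V ?R"
    using pres_rel.relator[of "[]" V "[]" "commutator_word u v" ?R] uv by auto
  then have one: "c (commutator_word u v) = \<one>\<^bsub>\<G>\<^esub>"
    using equiv_class_eq[OF equiv_pres_rel[OF relators_words]]
    by (auto simp: pc_group_def presented_group_def c_def)
  have g: "gen u = c [(u, True)]" "gen v = c [(v, True)]" by (simp_all add: pc_gen_def c_def)
  \<comment> \<open>The letters of the relator spell (v u)^-1 (u v), so its triviality says that the
    two products agree.\<close>
  have "inv\<^bsub>\<G>\<^esub> (gen v \<otimes>\<^bsub>\<G>\<^esub> gen u) \<otimes>\<^bsub>\<G>\<^esub> (gen u \<otimes>\<^bsub>\<G>\<^esub> gen v)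
      = (c [(u, False)] \<otimes>\<^bsub>\<G>\<^esub> c [(v, False)]) \<otimes>\<^bsub>\<G>\<^esub> (c [(u, True)] \<otimes>\<^bsub>\<G>\<^esub> c [(v, True)])"
    unfolding GG.inv_mult_group[OF gens(2,1)] inv by (simp only: g)
  also have "\<dots> = c (commutator_word u v)"
    using V by (simp add: mult commutator_word_def)
  finally have "inv\<^bsub>\<G>\<^esub> (gen v \<otimes>\<^bsub>\<G>\<^esub> gen u) \<otimes>\<^bsub>\<G>\<^esub> (gen u \<otimes>\<^bsub>\<G>\<^esub> gen v)
      = c (commutator_word u v)" .
  then have "inv\<^bsub>\<G>\<^esub> (gen v \<otimes>\<^bsub>\<G>\<^esub> gen u) \<otimes>\<^bsub>\<G>\<^esub> (gen u \<otimes>\<^bsub>\<G>\<^esub> gen v) = \<one>\<^bsub>\<G>\<^esub>"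
    using one by simp
  then have "inv\<^bsub>\<G>\<^esub> (gen u \<otimes>\<^bsub>\<G>\<^esub> gen v) = inv\<^bsub>\<G>\<^esub> (gen v \<otimes>\<^bsub>\<G>\<^esub> gen u)"
    using gens by (intro GG.inv_equality) simp_all
  then have "inv\<^bsub>\<G>\<^esub> (inv\<^bsub>\<G>\<^esub> (gen u \<otimes>\<^bsub>\<G>\<^esub> gen v)) = inv\<^bsub>\<G>\<^esub> (inv\<^bsub>\<G>\<^esub> (gen v \<otimes>\<^bsub>\<G>\<^esub> gen u))"
    by (simp only:)
  then show ?thesis using gens by (simp only: GG.inv_inv GG.m_closed)
qed

lemma pc_hom_eqI:
  assumes "group H" "\<phi> \<in> hom \<G> H" "\<psi> \<in> hom \<G> H"
    and "Y \<subseteq> V" "\<And>y. y \<in> Y \<Longrightarrow> \<phi> (gen y) = \<psi> (gen y)" "g \<in> sub Y"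
  shows "\<phi> g = \<psi> g"
proof (rule hom_eq_on_generate[of \<G> H \<phi> \<psi> "gen ` Y"])
  show "group_hom \<G> H \<phi>" "group_hom \<G> H \<psi>"
    using assms(1-3) GG.is_group by (simp_all add: group_hom_def group_hom_axioms_def)
  show "gen ` Y \<subseteq> carrier \<G>" using gen_image_carrier[OF assms(4)] .
  show "g \<in> generate \<G> (gen ` Y)" using assms(6) by (simp add: pc_sub_def)
  show "\<phi> a = \<psi> a" if "a \<in> gen ` Y" for a using that assms(5) by auto
qed

lemma pc_auto_eqI:
  assumes "\<phi> \<in> auto \<G>" "\<psi> \<in> auto \<G>" "\<And>v. v \<in> V \<Longrightarrow> \<phi> (gen v) = \<psi> (gen v)"
  shows "\<phi> = \<psi>"
proof (rule GG.auto_eqI[OF assms(1,2)])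
  fix g assume "g \<in> carrier \<G>"
  then have g: "g \<in> sub V" by (simp add: carrier_eq_sub)
  show "\<phi> g = \<psi> g"
    by (rule pc_hom_eqI[where \<phi> = \<phi> and \<psi> = \<psi>, OF GG.is_group _ _ order.refl _ g])
      (use assms in \<open>simp_all add: auto_def\<close>)
qed

lemma auto_fixes_sub:
  assumes "\<phi> \<in> auto \<G>" "Y \<subseteq> V" "\<And>y. y \<in> Y \<Longrightarrow> \<phi> (gen y) = gen y" "g \<in> sub Y"
  shows "\<phi> g = g"
proof (rule pc_hom_eqI[where \<psi> = "\<lambda>g. g", OF GG.is_group _ _ assms(2) _ assms(4)])
  show "\<phi> \<in> hom \<G> \<G>" using assms(1) by (simp add: auto_def)
  show "(\<lambda>g. g) \<in> hom \<G> \<G>" by (simp add: hom_def)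
  show "\<phi> (gen y) = gen y" if "y \<in> Y" for y by (rule assms(3)[OF that])
qed

lemma auto_maps_sub:
  assumes "\<phi> \<in> auto \<G>" "Y \<subseteq> V" "Z \<subseteq> V" "\<And>y. y \<in> Y \<Longrightarrow> \<phi> (gen y) \<in> sub Z" "g \<in> sub Y"
  shows "\<phi> g \<in> sub Z"
proof -
  have "\<phi> ` generate \<G> (gen ` Y) \<subseteq> sub Z"
    using assms(4) by (intro group_hom.generate_image_subset[OF GG.auto_hom[OF assms(1)]
      gen_image_carrier[OF assms(2)] subgroup_sub[OF assms(3)]]) (simp add: image_subset_iff)
  then show ?thesis using imageI[OF assms(5), of \<phi>] by (simp add: pc_sub_def subset_iff)
qed

section \<open>Exponent sums, commuting vertex sets and cliques\<close>

definition expo :: "'a \<Rightarrow> 'a gword set \<Rightarrow> int" where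
  "expo z = (SOME e. e \<in> hom \<G> integer_group \<and> (\<forall>v\<in>V. e (gen v) = (if v = z then 1 else 0)))"

text \<open>The integers commute, so any assignment of integers to vertices extends to a
  homomorphism; this one counts the occurrences of \<open>z\<close> with sign.\<close>

lemma expo: "expo z \<in> hom \<G> integer_group" "v \<in> V \<Longrightarrow> expo z (gen v) = (if v = z then 1 else 0)"
proof -
  obtain e where "e \<in> hom \<G> integer_group" "\<And>v. v \<in> V \<Longrightarrow> e (gen v) = (if v = z then 1 else 0)"
    by (rule pc_hom_exists[of integer_group "\<lambda>v. if v = z then 1 else 0"]) auto
  then have "\<exists>e. e \<in> hom \<G> integer_group \<and> (\<forall>v\<in>V. e (gen v) = (if v = z then 1 else 0))"
    by blast
  from someI_ex[OF this] show "expo z \<in> hom \<G> integer_group"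
    "v \<in> V \<Longrightarrow> expo z (gen v) = (if v = z then 1 else 0)"
    by (auto simp: expo_def)
qed

lemma expo_mult:
  "g \<in> carrier \<G> \<Longrightarrow> h \<in> carrier \<G> \<Longrightarrow> expo z (g \<otimes>\<^bsub>\<G>\<^esub> h) = expo z g + expo z h"
  using expo(1)[of z] by (auto simp: hom_def)

lemma group_hom_expo: "group_hom \<G> integer_group (expo z)"
  using expo(1) GG.is_group by (auto intro!: group_hom.intro group_hom_axioms.intro)

lemma expo_inv: "g \<in> carrier \<G> \<Longrightarrow> expo z (inv\<^bsub>\<G>\<^esub> g) = - expo z g"
  using group_hom.hom_inv[OF group_hom_expo] by simp

lemma expo_int_pow: "g \<in> carrier \<G> \<Longrightarrow> expo z (g [^]\<^bsub>\<G>\<^esub> (k::int)) = k * expo z g"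
  using group_hom.hom_int_pow[OF group_hom_expo] by simp

text \<open>On \<open>sub Y\<close> the exponent sum agrees with the zero homomorphism, since it
  does so on the generators.\<close>

lemma expo_eq_0:
  assumes "Y \<subseteq> V" "z \<notin> Y" "g \<in> sub Y"
  shows "expo z g = 0"
proof (rule pc_hom_eqI[OF group_integer_group expo(1) _ assms(1) _ assms(3)])
  show "(\<lambda>_. 0) \<in> hom \<G> integer_group" by (simp add: hom_def)
  show "expo z (gen y) = 0" if "y \<in> Y" for y
    using that assms(1,2) expo(2)[of y z] by auto
qed

text \<open>The alternative y = z covers overlapping vertex sets, as arcs are irreflexive.\<close>

lemma sub_commute:
  assumes "Y \<subseteq> V" "Z \<subseteq> V" "\<And>y z. y \<in> Y \<Longrightarrow> z \<in> Z \<Longrightarrow> y = z \<or> (y, z) \<in> parcs \<Gamma>"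
    and "g \<in> sub Y" "h \<in> sub Z"
  shows "g \<otimes>\<^bsub>\<G>\<^esub> h = h \<otimes>\<^bsub>\<G>\<^esub> g"
proof (rule GG.generate_commute)
  show "gen ` Y \<subseteq> carrier \<G>" "gen ` Z \<subseteq> carrier \<G>" using assms gen_image_carrier by auto
  show "g \<in> generate \<G> (gen ` Y)" "h \<in> generate \<G> (gen ` Z)" using assms by (auto simp: pc_sub_def)
  show "a \<otimes>\<^bsub>\<G>\<^esub> b = b \<otimes>\<^bsub>\<G>\<^esub> a" if "a \<in> gen ` Y" "b \<in> gen ` Z" for a b
    using that assms(3) gen_commute_arc by fastforce
qed

lemma sub_Un_commuting:
  assumes "Y \<subseteq> V" "Z \<subseteq> V" "\<And>y z. y \<in> Y \<Longrightarrow> z \<in> Z \<Longrightarrow> y = z \<or> (y, z) \<in> parcs \<Gamma>"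
    and "g \<in> sub (Y \<union> Z)"
  shows "\<exists>a \<in> sub Y. \<exists>b \<in> sub Z. g = a \<otimes>\<^bsub>\<G>\<^esub> b"
  unfolding pc_sub_def
proof (rule GG.generate_Un_commuting)
  show "gen ` Y \<subseteq> carrier \<G>" "gen ` Z \<subseteq> carrier \<G>" using assms gen_image_carrier by auto
  show "g \<in> generate \<G> (gen ` Y \<union> gen ` Z)" using assms by (auto simp: pc_sub_def image_Un)
  show "a \<otimes>\<^bsub>\<G>\<^esub> b = b \<otimes>\<^bsub>\<G>\<^esub> a" if "a \<in> gen ` Y" "b \<in> gen ` Z" for a b
    using that assms(3) gen_commute_arc by fastforce
qed

text \<open>Exponent sums separate the elements of \<open>sub C\<close> from the identity, the part
  of free abelian structure that later gives injectivity. The induction splits one vertex off the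
  clique and kills its power.\<close>

lemma clique_sub_trivial:
  assumes "finite C" "C \<subseteq> V" "\<And>y z. y \<in> C \<Longrightarrow> z \<in> C \<Longrightarrow> y = z \<or> (y, z) \<in> parcs \<Gamma>"
    and "c \<in> sub C" "\<And>z. z \<in> C \<Longrightarrow> expo z c = 0"
  shows "c = \<one>\<^bsub>\<G>\<^esub>"
  using assms
proof (induction C arbitrary: c rule: finite_induct)
  case empty
  then show ?case by (simp add: pc_sub_def GG.generate_empty)
next
  case (insert z C)
  then have z: "z \<in> V" and C: "C \<subseteq> V" by auto
  obtain a b where ab: "a \<in> sub {z}" "b \<in> sub C" "c = a \<otimes>\<^bsub>\<G>\<^esub> b"
    using sub_Un_commuting[of "{z}" C c] insert.prems by auto
  obtain k :: int where k: "a = gen z [^]\<^bsub>\<G>\<^esub> k"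
    using ab(1) GG.generate_pow[OF gen_carrier[OF z]] by (auto simp: pc_sub_def)
  have car: "a \<in> carrier \<G>" "b \<in> carrier \<G>"
    using ab sub_subset_carrier[OF C] sub_subset_carrier[of "{z}"] z by auto
  \<comment> \<open>\<open>z\<close> is not in the smaller clique, so the exponent of
    \<open>z\<close> in \<open>c\<close> comes from \<open>a\<close> alone and equals
    \<open>k\<close>.\<close>
  have "expo z b = 0" using expo_eq_0[OF C insert.hyps(2) ab(2)] .
  then have "k = 0"
    using insert.prems(4)[of z] car gen_carrier[OF z] expo(2)[OF z]
    by (simp add: ab(3) expo_mult k expo_int_pow)
  then have cb: "c = b" using ab k car by simp
  show ?case
    unfolding cb
  proof (rule insert.IH[OF C _ ab(2)])
    show "v = w \<or> (v, w) \<in> parcs \<Gamma>" if "v \<in> C" "w \<in> C" for v w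
      using insert.prems(2) that by simp
    show "expo w b = 0" if "w \<in> C" for w using insert.prems(4)[of w] that cb by simp
  qed
qed

text \<open>A product of the powers \<open>gen z [^] n z\<close>; it makes the passage to matrices
  surjective.\<close>

lemma sub_expo_exists:
  fixes n :: "'a \<Rightarrow> int"
  assumes "finite C" "C \<subseteq> V"
  shows "\<exists>c \<in> sub C. \<forall>z \<in> C. expo z c = n z"
  using assms
proof (induction C rule: finite_induct)
  case empty
  then show ?case by (auto simp: pc_sub_def intro: generate.one)
next
  case (insert z C)
  then have z: "z \<in> V" and C: "C \<subseteq> V" by auto
  obtain c where c: "c \<in> sub C" "\<forall>w \<in> C. expo w c = n w" using insert by auto
  let ?a = "gen z [^]\<^bsub>\<G>\<^esub> n z"
  have gz: "gen z \<in> carrier \<G>" using z by (rule gen_carrier)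
  have "c \<in> carrier \<G>" using c sub_subset_carrier[OF C] by auto
  moreover have "?a \<in> sub (insert z C)"
    using sub_mono[of "{z}" "insert z C"] GG.generate_pow[OF gz] by (auto simp: pc_sub_def)
  moreover have "c \<in> sub (insert z C)" using c sub_mono[of C "insert z C"] by auto
  ultimately show ?case
    using c insert.hyps expo_eq_0[OF C insert.hyps(2) c(1)] gz z expo(2)[OF z]
    by (intro bexI[of _ "?a \<otimes>\<^bsub>\<G>\<^esub> c"])
      (auto simp: expo_mult expo_int_pow pc_sub_def intro: generate.eng)
qed

end

section \<open>Automorphisms supported on one vertex class\<close>

locale raag_vertex = raag +
  fixes x :: 'a
  assumes x: "x \<in> pverts \<Gamma>" and adm_ne: "adm \<Gamma> x \<noteq> cl \<Gamma> x"
begin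

section \<open>Graph combinatorics around the class of x\<close>

abbreviation "K \<equiv> vclass \<Gamma> x"
abbreviation "A \<equiv> adm \<Gamma> x"
text \<open>\<open>cl \<Gamma> x \<union> K\<close> is the disjoint union of \<open>K\<close> and
  \<open>C\<close>, so \<open>card C\<close> is the q - p of the theorem.\<close>

abbreviation "C \<equiv> cl \<Gamma> x - K"
abbreviation "U \<equiv> K \<union> adm_out \<Gamma> x"

text \<open>Passing from \<open>lk \<Gamma> x\<close> to \<open>st \<Gamma> x\<close> adds only x to
  the index set, hence one further condition, membership in \<open>st \<Gamma> x\<close>.\<close>

lemma cl_eq: "cl \<Gamma> x = A \<inter> st \<Gamma> x"
  using x by (auto simp: cl_def adm_def st_def lk_def dest: in_arcsD2)

text \<open>A vertex of \<open>A\<close> not adjacent to \<open>x\<close> rules out \<open>st x = st y\<close> for \<open>y \<noteq> x\<close>.\<close>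

lemma lk_vclass:
  assumes "y \<in> K"
  shows "lk \<Gamma> y = lk \<Gamma> x"
proof (rule ccontr)
  assume ne: "lk \<Gamma> y \<noteq> lk \<Gamma> x"
  then have st: "st \<Gamma> x = st \<Gamma> y" using assms by (auto simp: vclass_def)
  with ne have "y \<noteq> x" by auto
  then have y: "y \<in> lk \<Gamma> x" using st by (auto simp: st_def)
  have "A \<subseteq> st \<Gamma> y" using y by (auto simp: adm_def)
  then show False using adm_ne cl_eq st by auto
qed

lemma x_in_K: "x \<in> K"
  using x by (simp add: vclass_def)

lemma K_subset: "K \<subseteq> V"
  by (auto simp: vclass_def)

lemma A_subset: "A \<subseteq> V"
  by (auto simp: adm_def)

lemma K_subset_A: "K \<subseteq> A"
proof
  fix y assume y: "y \<in> K"
  show "y \<in> A"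
    using lk_vclass[OF y] y arc_sym by (auto simp: adm_def vclass_def st_def lk_def)
qed

lemma C_subset: "C \<subseteq> V"
  using A_subset cl_eq by auto

lemma U_subset: "U \<subseteq> V"
  using A_subset K_subset by (auto simp: adm_out_def)

lemma A_eq: "A = U \<union> C"
  using K_subset_A cl_eq by (auto simp: adm_out_def)

lemma U_disjoint_C: "z \<in> C \<Longrightarrow> z \<notin> U"
  by (auto simp: adm_out_def)

lemma C_arc_lk: "z \<in> C \<Longrightarrow> v \<in> lk \<Gamma> x \<Longrightarrow> z = v \<or> (z, v) \<in> parcs \<Gamma>"
  using cl_eq arc_sym by (auto simp: adm_def st_def lk_def)

text \<open>\<open>C\<close> lies in the star of x, and x itself was removed together with
  \<open>K\<close>.\<close>

lemma C_lk: "z \<in> C \<Longrightarrow> z \<in> lk \<Gamma> x"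
  using cl_eq x_in_K by (auto simp: st_def)

text \<open>By \<open>C_lk\<close>, \<open>st \<Gamma> z\<close> is one of the stars whose
  intersection is \<open>A\<close>. This is the source of centrality.\<close>

lemma C_arc_A: "z \<in> C \<Longrightarrow> a \<in> A \<Longrightarrow> z = a \<or> (z, a) \<in> parcs \<Gamma>"
  using C_lk by (auto simp: adm_def st_def lk_def)

lemma A_arc_C: "a \<in> A \<Longrightarrow> z \<in> C \<Longrightarrow> a = z \<or> (a, z) \<in> parcs \<Gamma>"
  using C_arc_A[of z a] arc_sym by auto

lemma C_clique: "y \<in> C \<Longrightarrow> z \<in> C \<Longrightarrow> y = z \<or> (y, z) \<in> parcs \<Gamma>"
  using C_arc_A[of y z] A_eq by auto

text \<open>This is why y |-> y c with c in \<open>sub C\<close> preserves every admissible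
  subgroup. If w = y, then z is adjacent to w because y has the link of x. Otherwise w is adjacent
  to y, hence to x, and \<open>C_arc_lk\<close> applies.\<close>

lemma C_subset_adm:
  assumes y: "y \<in> K" and yu: "y \<in> adm \<Gamma> u"
  shows "C \<subseteq> adm \<Gamma> u"
proof
  fix z assume z: "z \<in> C"
  have "z \<in> st \<Gamma> w" if w: "w \<in> lk \<Gamma> u" for w
  proof (cases "w = y")
    case True
    then show ?thesis using C_lk[OF z] lk_vclass[OF y] by (simp add: st_def)
  next
    case False
    then have "w \<in> lk \<Gamma> y" using yu w arc_sym by (auto simp: adm_def st_def lk_def)
    then show ?thesis using C_arc_lk[OF z] lk_vclass[OF y] arc_sym by (auto simp: st_def lk_def)
  qed
  then show "z \<in> adm \<Gamma> u" using z C_subset by (auto simp: adm_def)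
qed

section \<open>The central subgroup generated by C\<close>

lemma sub_C_carrier: "c \<in> sub C \<Longrightarrow> c \<in> carrier \<G>"
  using sub_subset_carrier[OF C_subset] by (rule subsetD)

lemma sub_A_carrier: "g \<in> sub A \<Longrightarrow> g \<in> carrier \<G>"
  using sub_subset_carrier[OF A_subset] by (rule subsetD)

lemma sub_U_carrier: "g \<in> sub U \<Longrightarrow> g \<in> carrier \<G>"
  using sub_subset_carrier[OF U_subset] by (rule subsetD)

lemma gen_K_carrier: "y \<in> K \<Longrightarrow> gen y \<in> carrier \<G>"
  by (rule gen_carrier[OF subsetD[OF K_subset]])

lemma C_central: "c \<in> sub C \<Longrightarrow> g \<in> sub A \<Longrightarrow> c \<otimes>\<^bsub>\<G>\<^esub> g = g \<otimes>\<^bsub>\<G>\<^esub> c"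
  by (rule sub_commute[OF C_subset A_subset C_arc_A])

text \<open>An element of \<open>sub U\<close> has exponent 0 at each vertex of \<open>C\<close>,
  and inside \<open>sub C\<close> these exponents detect triviality.\<close>

lemma sub_U_C_trivial:
  assumes "c \<in> sub U" "c \<in> sub C"
  shows "c = \<one>\<^bsub>\<G>\<^esub>"
proof (rule clique_sub_trivial[OF _ C_subset C_clique assms(2)])
  show "finite C" using finite_subset[OF C_subset finite_verts] .
  show "expo z c = 0" if "z \<in> C" for z
    using expo_eq_0[OF U_subset U_disjoint_C[OF that] assms(1)] .
qed

lemma subgroup_C: "subgroup (sub C) \<G>"
  by (rule subgroup_sub[OF C_subset])

section \<open>The automorphisms supported on K form a group\<close>

lemma StvD:
  assumes "\<phi> \<in> Stv \<Gamma> x"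
  shows "\<phi> \<in> auto \<G>" "\<phi> ` sub A = sub A" "\<And>v. v \<in> V - K \<Longrightarrow> \<phi> (gen v) = gen v"
  using assms x by (auto simp: Stv_def StK_def adm_sets_def)

text \<open>\<open>C\<close> is disjoint from \<open>K\<close>, so its generators are among those
  that \<phi> fixes.\<close>

lemma Stv_fixes_C:
  assumes "\<phi> \<in> Stv \<Gamma> x" "c \<in> sub C"
  shows "\<phi> c = c"
proof (rule auto_fixes_sub[OF StvD(1)[OF assms(1)] C_subset _ assms(2)])
  show "\<phi> (gen z) = gen z" if "z \<in> C" for z
    using that C_subset by (intro StvD(3)[OF assms(1)]) auto
qed

lemma subgroup_Stv: "subgroup (Stv \<Gamma> x) \<A>"
proof (rule group.subgroupI[OF GG.AutoGroup])
  have sub_adm: "sub Y \<subseteq> carrier \<G>" if "Y \<in> adm_sets \<Gamma>" for Y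
    using that by (intro sub_subset_carrier) (auto simp: adm_sets_def adm_def)
  show "Stv \<Gamma> x \<subseteq> carrier \<A>" by (auto simp: Stv_def StK_def)
  \<comment> \<open>The unit is the identity restricted to the carrier, so its action on
    \<open>sub Y\<close> is known only through the inclusion of \<open>sub Y\<close> in the
    carrier.\<close>
  have "\<one>\<^bsub>\<A>\<^esub> ` sub Y = sub Y" if "Y \<in> adm_sets \<Gamma>" for Y
    using image_cong[OF HOL.refl, of "sub Y" "\<one>\<^bsub>\<A>\<^esub>" "\<lambda>g. g"]
      GG.AutoGroup_one_apply subsetD[OF sub_adm[OF that]] by simp
  then have "\<one>\<^bsub>\<A>\<^esub> \<in> Stv \<Gamma> x"
    using GG.AutoGroup_one_closed GG.AutoGroup_one_apply gen_carrier
    by (simp add: Stv_def StK_def)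
  then show "Stv \<Gamma> x \<noteq> {}" by auto
  fix \<phi> assume phi: "\<phi> \<in> Stv \<Gamma> x"
  then have phi_a: "\<phi> \<in> auto \<G>" by (rule StvD)
  have phi_Y: "\<phi> ` sub Y = sub Y" if "Y \<in> adm_sets \<Gamma>" for Y
    using phi that by (simp add: Stv_def StK_def)
  let ?i = "inv\<^bsub>\<A>\<^esub> \<phi>"
  have "?i ` sub Y = sub Y" if Y: "Y \<in> adm_sets \<Gamma>" for Y
  proof -
    \<comment> \<open>\<phi> maps \<open>sub Y\<close> onto itself, not merely into itself; hence
      the inverse preserves it as well.\<close>
    have "?i ` sub Y = ?i ` (\<phi> ` sub Y)" by (simp only: phi_Y[OF Y])
    also have "\<dots> = (\<lambda>g. g) ` sub Y"
      unfolding image_image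
      using GG.AutoGroup_inv_apply(1)[OF phi_a] subsetD[OF sub_adm[OF Y]]
      by (intro image_cong) simp_all
    finally show ?thesis by simp
  qed
  moreover have "?i (gen v) = gen v" if v: "v \<in> V - K" for v
    using GG.AutoGroup_inv_apply(1)[OF phi_a gen_carrier, of v] StvD(3)[OF phi v] v by simp
  ultimately show "?i \<in> Stv \<Gamma> x"
    using GG.AutoGroup_inv_closed[OF phi_a] by (simp add: Stv_def StK_def)
  fix \<psi> assume psi: "\<psi> \<in> Stv \<Gamma> x"
  then have psi_a: "\<psi> \<in> auto \<G>" by (rule StvD)
  note app = GG.AutoGroup_mult_apply[OF phi_a psi_a]
  have "(\<phi> \<otimes>\<^bsub>\<A>\<^esub> \<psi>) ` sub Y = sub Y" if Y: "Y \<in> adm_sets \<Gamma>" for Y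
  proof -
    have "(\<phi> \<otimes>\<^bsub>\<A>\<^esub> \<psi>) ` sub Y = \<phi> ` (\<psi> ` sub Y)"
      unfolding image_image using app subsetD[OF sub_adm[OF Y]] by (intro image_cong) simp_all
    also have "\<dots> = sub Y" using phi_Y[OF Y] psi Y by (simp add: Stv_def StK_def)
    finally show ?thesis .
  qed
  moreover have "(\<phi> \<otimes>\<^bsub>\<A>\<^esub> \<psi>) (gen v) = gen v" if v: "v \<in> V - K" for v
    using app[OF gen_carrier, of v] StvD(3)[OF phi v] StvD(3)[OF psi v] v by simp
  ultimately show "\<phi> \<otimes>\<^bsub>\<A>\<^esub> \<psi> \<in> Stv \<Gamma> x"
    using GG.AutoGroup_mult_closed[OF phi_a psi_a] by (simp add: Stv_def StK_def)
qed

lemma Stv_inv: "\<phi> \<in> Stv \<Gamma> x \<Longrightarrow> inv\<^bsub>\<A>\<^esub> \<phi> \<in> Stv \<Gamma> x"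
  by (rule subgroup.m_inv_closed[OF subgroup_Stv])

lemma Stv_mult: "\<phi> \<in> Stv \<Gamma> x \<Longrightarrow> \<psi> \<in> Stv \<Gamma> x \<Longrightarrow> \<phi> \<otimes>\<^bsub>\<A>\<^esub> \<psi> \<in> Stv \<Gamma> x"
  by (rule subgroup.m_closed[OF subgroup_Stv])

lemma Stv_apply_A: "\<phi> \<in> Stv \<Gamma> x \<Longrightarrow> g \<in> sub A \<Longrightarrow> \<phi> g \<in> sub A"
  using imageI[of g "sub A" \<phi>] by (simp only: StvD(2))

lemma sub_A_split:
  assumes "g \<in> sub A"
  obtains l c where "l \<in> sub U" "c \<in> sub C" "g = l \<otimes>\<^bsub>\<G>\<^esub> c"
proof -
  have "\<exists>l \<in> sub U. \<exists>c \<in> sub C. g = l \<otimes>\<^bsub>\<G>\<^esub> c"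
    using assms A_eq by (intro sub_Un_commuting[OF U_subset C_subset] A_arc_C) auto
  then show ?thesis using that by auto
qed

section \<open>The complement\<close>

definition Stv_l :: "('a gword set \<Rightarrow> 'a gword set) set" where
  "Stv_l = {\<phi> \<in> Stv \<Gamma> x. \<forall>y \<in> K. \<phi> (gen y) \<in> sub U}"

definition Stv_s :: "('a gword set \<Rightarrow> 'a gword set) set" where
  "Stv_s = {\<phi> \<in> Stv \<Gamma> x. \<forall>y \<in> K. \<exists>c \<in> sub C. \<phi> (gen y) = gen y \<otimes>\<^bsub>\<G>\<^esub> c}"

lemma gen_K_sub: "y \<in> K \<Longrightarrow> gen y \<in> sub U" "y \<in> K \<Longrightarrow> gen y \<in> sub A"
  using K_subset_A by (auto intro!: gen_in_sub)

text \<open>The remaining generators of \<open>sub U\<close> lie outside \<open>K\<close> and are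
  fixed, so control over \<open>K\<close> is enough.\<close>

lemma Stv_l_apply_U:
  assumes "\<phi> \<in> Stv_l" "g \<in> sub U"
  shows "\<phi> g \<in> sub U"
proof (rule auto_maps_sub[OF _ U_subset U_subset _ assms(2)])
  have phi: "\<phi> \<in> Stv \<Gamma> x" using assms by (simp add: Stv_l_def)
  then show "\<phi> \<in> auto \<G>" by (rule StvD)
  fix y assume y: "y \<in> U"
  show "\<phi> (gen y) \<in> sub U"
  proof (cases "y \<in> K")
    case False
    then have "y \<in> V - K" using y U_subset by auto
    then show ?thesis using StvD(3)[OF phi] gen_in_sub[OF y] by simp
  qed (use assms in \<open>simp add: Stv_l_def\<close>)
qed

lemma subgroup_Stv_l: "subgroup Stv_l \<A>"
proof (rule group.subgroupI[OF GG.AutoGroup])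
  show "Stv_l \<subseteq> carrier \<A>" using StvD(1) by (auto simp: Stv_l_def)
  have "\<one>\<^bsub>\<A>\<^esub> \<in> Stv_l"
    using subgroup.one_closed[OF subgroup_Stv] GG.AutoGroup_one_apply gen_K_carrier gen_K_sub
    by (simp add: Stv_l_def)
  then show "Stv_l \<noteq> {}" by auto
  fix \<phi> assume phi_l: "\<phi> \<in> Stv_l"
  then have phi: "\<phi> \<in> Stv \<Gamma> x" by (simp add: Stv_l_def)
  note phi_a = StvD(1)[OF phi]
  have "(inv\<^bsub>\<A>\<^esub> \<phi>) (gen y) \<in> sub U" if y: "y \<in> K" for y
  proof -
    let ?g = "(inv\<^bsub>\<A>\<^esub> \<phi>) (gen y)"
    have "?g \<in> sub A" by (rule Stv_apply_A[OF Stv_inv[OF phi] gen_K_sub(2)[OF y]])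
    \<comment> \<open>Applying \<phi> to this splitting gives y = \<phi>(l) c with \<phi>(l) in
      \<open>sub U\<close>. Hence c lies in both \<open>sub U\<close> and \<open>sub C\<close> and
      is trivial.\<close>
    then obtain l c where lc: "l \<in> sub U" "c \<in> sub C" "?g = l \<otimes>\<^bsub>\<G>\<^esub> c" by (rule sub_A_split)
    have "gen y = \<phi> ?g" using GG.AutoGroup_inv_apply(2)[OF phi_a gen_K_carrier[OF y]] by simp
    also have "\<dots> = \<phi> l \<otimes>\<^bsub>\<G>\<^esub> c"
      using lc GG.auto_mult[OF phi_a sub_U_carrier sub_C_carrier] Stv_fixes_C[OF phi] by simp
    finally have "\<phi> l \<otimes>\<^bsub>\<G>\<^esub> c \<in> sub U" using gen_K_sub(1)[OF y] by simp
    then have "c \<in> sub U"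
      using GG.mult_in_generate_iff[OF gen_image_carrier[OF U_subset]]
        Stv_l_apply_U[OF phi_l lc(1)] sub_C_carrier[OF lc(2)] by (simp add: pc_sub_def)
    then have "c = \<one>\<^bsub>\<G>\<^esub>" using lc(2) by (rule sub_U_C_trivial)
    then show ?thesis using lc sub_U_carrier by simp
  qed
  then show "inv\<^bsub>\<A>\<^esub> \<phi> \<in> Stv_l" using Stv_inv[OF phi] by (simp add: Stv_l_def)
  fix \<psi> assume psi_l: "\<psi> \<in> Stv_l"
  then have psi: "\<psi> \<in> Stv \<Gamma> x" by (simp add: Stv_l_def)
  have "(\<phi> \<otimes>\<^bsub>\<A>\<^esub> \<psi>) (gen y) \<in> sub U" if y: "y \<in> K" for y
    using GG.AutoGroup_mult_apply[OF phi_a StvD(1)[OF psi] gen_K_carrier[OF y]]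
      Stv_l_apply_U[OF phi_l Stv_l_apply_U[OF psi_l gen_K_sub(1)[OF y]]] by simp
  then show "\<phi> \<otimes>\<^bsub>\<A>\<^esub> \<psi> \<in> Stv_l" using Stv_mult[OF phi psi] by (simp add: Stv_l_def)
qed

section \<open>The normal factor\<close>

lemma Stv_sE:
  assumes "\<phi> \<in> Stv_s" "y \<in> K"
  obtains c where "c \<in> sub C" "\<phi> (gen y) = gen y \<otimes>\<^bsub>\<G>\<^esub> c"
  using assms by (auto simp: Stv_s_def)

text \<open>Extends the defining condition from \<open>K\<close> to all of \<open>sub A\<close>.
  Centrality of \<open>sub C\<close> lets the correction terms of a product be collected at its
  right end.\<close>

lemma Stv_s_apply_A:
  assumes "\<phi> \<in> Stv_s" "g \<in> sub A"
  shows "\<exists>c \<in> sub C. \<phi> g = g \<otimes>\<^bsub>\<G>\<^esub> c"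
proof -
  have phi: "\<phi> \<in> Stv \<Gamma> x" using assms by (simp add: Stv_s_def)
  interpret phi: group_hom \<G> \<G> \<phi> by (rule GG.auto_hom[OF StvD(1)[OF phi]])
  have one_C: "\<one>\<^bsub>\<G>\<^esub> \<in> sub C" by (rule subgroup.one_closed[OF subgroup_C])
  have gen: "\<exists>c \<in> sub C. \<phi> (gen y) = gen y \<otimes>\<^bsub>\<G>\<^esub> c" if y: "y \<in> A" for y
  proof (cases "y \<in> K")
    case False
    then have "y \<in> V - K" using y A_subset by auto
    then show ?thesis
      using StvD(3)[OF phi] gen_carrier one_C by (intro bexI[of _ "\<one>\<^bsub>\<G>\<^esub>"]) simp_all
  qed (use assms in \<open>simp add: Stv_s_def\<close>)
  have "g \<in> generate \<G> (gen ` A)" using assms(2) by (simp add: pc_sub_def)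
  then show ?thesis
  proof induction
    case one
    then show ?case using one_C by (intro bexI[of _ "\<one>\<^bsub>\<G>\<^esub>"]) simp_all
  next
    case (incl h)
    then show ?case using gen by (elim imageE) simp
  next
    case (inv h)
    then obtain y where y: "y \<in> A" "h = gen y" by (elim imageE)
    then obtain c where c: "c \<in> sub C" "\<phi> h = h \<otimes>\<^bsub>\<G>\<^esub> c" using gen[OF y(1)] by auto
    have h: "h \<in> carrier \<G>" "h \<in> sub A"
      using y sub_A_carrier gen_in_sub by simp_all
    have cc: "c \<in> carrier \<G>" using c sub_C_carrier by simp
    \<comment> \<open>Commuting c past h before inverting puts c^-1 on the required side.\<close>
    have "\<phi> (inv\<^bsub>\<G>\<^esub> h) = inv\<^bsub>\<G>\<^esub> (c \<otimes>\<^bsub>\<G>\<^esub> h)"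
      using h c C_central[OF c(1) h(2)] by simp
    also have "\<dots> = inv\<^bsub>\<G>\<^esub> h \<otimes>\<^bsub>\<G>\<^esub> inv\<^bsub>\<G>\<^esub> c" using h cc by (simp add: GG.inv_mult_group)
    finally show ?case
      using subgroup.m_inv_closed[OF subgroup_C c(1)] by (intro bexI[of _ "inv\<^bsub>\<G>\<^esub> c"])
  next
    case (eng h k)
    then obtain c d where cd: "c \<in> sub C" "\<phi> h = h \<otimes>\<^bsub>\<G>\<^esub> c" "d \<in> sub C" "\<phi> k = k \<otimes>\<^bsub>\<G>\<^esub> d"
      by (elim bexE)
    have hk: "h \<in> sub A" "k \<in> sub A" using eng by (simp_all add: pc_sub_def)
    note car = sub_A_carrier[OF hk(1)] sub_A_carrier[OF hk(2)]
      sub_C_carrier[OF cd(1)] sub_C_carrier[OF cd(3)]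
    have "\<phi> (h \<otimes>\<^bsub>\<G>\<^esub> k) = h \<otimes>\<^bsub>\<G>\<^esub> (c \<otimes>\<^bsub>\<G>\<^esub> k) \<otimes>\<^bsub>\<G>\<^esub> d" using car cd by (simp add: GG.m_assoc)
    also have "c \<otimes>\<^bsub>\<G>\<^esub> k = k \<otimes>\<^bsub>\<G>\<^esub> c" by (rule C_central[OF cd(1) hk(2)])
    also have "h \<otimes>\<^bsub>\<G>\<^esub> (k \<otimes>\<^bsub>\<G>\<^esub> c) \<otimes>\<^bsub>\<G>\<^esub> d = h \<otimes>\<^bsub>\<G>\<^esub> k \<otimes>\<^bsub>\<G>\<^esub> (c \<otimes>\<^bsub>\<G>\<^esub> d)"
      using car by (simp add: GG.m_assoc)
    finally show ?case
      using subgroup.m_closed[OF subgroup_C cd(1,3)] by (intro bexI[of _ "c \<otimes>\<^bsub>\<G>\<^esub> d"])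
  qed
qed

text \<open>The outer map fixes d, so composition just multiplies the correction terms; exponents
  then add.\<close>

lemma Stv_s_mult_gen:
  assumes phi: "\<phi> \<in> Stv_s" and psi: "\<psi> \<in> Stv_s" and y: "y \<in> K"
    and c: "c \<in> sub C" "\<phi> (gen y) = gen y \<otimes>\<^bsub>\<G>\<^esub> c" and d: "d \<in> sub C" "\<psi> (gen y) = gen y \<otimes>\<^bsub>\<G>\<^esub> d"
  shows "(\<phi> \<otimes>\<^bsub>\<A>\<^esub> \<psi>) (gen y) = gen y \<otimes>\<^bsub>\<G>\<^esub> (c \<otimes>\<^bsub>\<G>\<^esub> d)"
proof -
  have phi': "\<phi> \<in> Stv \<Gamma> x" and psi': "\<psi> \<in> Stv \<Gamma> x" using phi psi by (simp_all add: Stv_s_def)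
  note car = gen_K_carrier[OF y] sub_C_carrier[OF c(1)] sub_C_carrier[OF d(1)]
  have "(\<phi> \<otimes>\<^bsub>\<A>\<^esub> \<psi>) (gen y) = \<phi> (gen y \<otimes>\<^bsub>\<G>\<^esub> d)"
    using GG.AutoGroup_mult_apply[OF StvD(1)[OF phi'] StvD(1)[OF psi'] car(1)] d by simp
  also have "\<dots> = gen y \<otimes>\<^bsub>\<G>\<^esub> c \<otimes>\<^bsub>\<G>\<^esub> d"
    using GG.auto_mult[OF StvD(1)[OF phi'] car(1,3)] c Stv_fixes_C[OF phi' d(1)] by simp
  finally show ?thesis using car by (simp add: GG.m_assoc)
qed

lemma subgroup_Stv_s: "subgroup Stv_s \<A>"
proof (rule group.subgroupI[OF GG.AutoGroup])
  show "Stv_s \<subseteq> carrier \<A>" using StvD(1) by (auto simp: Stv_s_def)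
  have "\<exists>c\<in>sub C. \<one>\<^bsub>\<A>\<^esub> (gen y) = gen y \<otimes>\<^bsub>\<G>\<^esub> c" if "y \<in> K" for y
    using gen_K_carrier[OF that] subgroup.one_closed[OF subgroup_C]
    by (intro bexI[of _ "\<one>\<^bsub>\<G>\<^esub>"]) (simp_all add: GG.AutoGroup_one_apply)
  then have "\<one>\<^bsub>\<A>\<^esub> \<in> Stv_s"
    using subgroup.one_closed[OF subgroup_Stv] by (simp add: Stv_s_def)
  then show "Stv_s \<noteq> {}" by auto
  fix \<phi> assume phi_s: "\<phi> \<in> Stv_s"
  then have phi: "\<phi> \<in> Stv \<Gamma> x" by (simp add: Stv_s_def)
  let ?i = "inv\<^bsub>\<A>\<^esub> \<phi>"
  have i: "?i \<in> Stv \<Gamma> x" by (rule Stv_inv[OF phi])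
  have "\<exists>c\<in>sub C. ?i (gen y) = gen y \<otimes>\<^bsub>\<G>\<^esub> c" if y: "y \<in> K" for y
  proof -
    obtain c where c: "c \<in> sub C" "\<phi> (gen y) = gen y \<otimes>\<^bsub>\<G>\<^esub> c" by (rule Stv_sE[OF phi_s y])
    note car = gen_K_carrier[OF y] sub_C_carrier[OF c(1)]
    \<comment> \<open>The inverse fixes c too, which leaves an equation that can be solved for its
      value at y.\<close>
    have "gen y = ?i (gen y \<otimes>\<^bsub>\<G>\<^esub> c)"
      using GG.AutoGroup_inv_apply(1)[OF StvD(1)[OF phi] car(1)] c by simp
    also have "\<dots> = ?i (gen y) \<otimes>\<^bsub>\<G>\<^esub> c"
      using GG.auto_mult[OF StvD(1)[OF i] car] Stv_fixes_C[OF i c(1)] by simp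
    finally have "?i (gen y) \<otimes>\<^bsub>\<G>\<^esub> c = gen y" by simp
    then have "?i (gen y) = gen y \<otimes>\<^bsub>\<G>\<^esub> inv\<^bsub>\<G>\<^esub> c"
      using car GG.auto_in_carrier[OF StvD(1)[OF i] car(1)] by (simp add: GG.inv_solve_right)
    then show ?thesis using subgroup.m_inv_closed[OF subgroup_C c(1)] by (intro bexI[of _ "inv\<^bsub>\<G>\<^esub> c"])
  qed
  then show "?i \<in> Stv_s" using i by (simp add: Stv_s_def)
  fix \<psi> assume psi_s: "\<psi> \<in> Stv_s"
  then have psi: "\<psi> \<in> Stv \<Gamma> x" by (simp add: Stv_s_def)
  have "\<exists>c\<in>sub C. (\<phi> \<otimes>\<^bsub>\<A>\<^esub> \<psi>) (gen y) = gen y \<otimes>\<^bsub>\<G>\<^esub> c" if y: "y \<in> K" for y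
  proof -
    obtain c where c: "c \<in> sub C" "\<phi> (gen y) = gen y \<otimes>\<^bsub>\<G>\<^esub> c" by (rule Stv_sE[OF phi_s y])
    obtain d where d: "d \<in> sub C" "\<psi> (gen y) = gen y \<otimes>\<^bsub>\<G>\<^esub> d" by (rule Stv_sE[OF psi_s y])
    show ?thesis
      using Stv_s_mult_gen[OF phi_s psi_s y c d] subgroup.m_closed[OF subgroup_C c(1) d(1)]
      by (intro bexI[of _ "c \<otimes>\<^bsub>\<G>\<^esub> d"])
  qed
  then show "\<phi> \<otimes>\<^bsub>\<A>\<^esub> \<psi> \<in> Stv_s" using Stv_mult[OF phi psi] by (simp add: Stv_s_def)
qed

text \<open>With g = \<phi>^-1 y in \<open>sub A\<close>, \<theta> multiplies g by some c in
  \<open>sub C\<close>; \<phi> then returns g to y and fixes c.\<close>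

lemma Stv_s_conjugate:
  assumes phi: "\<phi> \<in> Stv \<Gamma> x" and theta_s: "\<theta> \<in> Stv_s"
  shows "\<phi> \<otimes>\<^bsub>\<A>\<^esub> \<theta> \<otimes>\<^bsub>\<A>\<^esub> inv\<^bsub>\<A>\<^esub> \<phi> \<in> Stv_s"
proof -
  have theta: "\<theta> \<in> Stv \<Gamma> x" using theta_s by (simp add: Stv_s_def)
  let ?i = "inv\<^bsub>\<A>\<^esub> \<phi>"
  have i: "?i \<in> Stv \<Gamma> x" by (rule Stv_inv[OF phi])
  note a = StvD(1)[OF phi] StvD(1)[OF theta] StvD(1)[OF i]
  have "\<exists>c\<in>sub C. (\<phi> \<otimes>\<^bsub>\<A>\<^esub> \<theta> \<otimes>\<^bsub>\<A>\<^esub> ?i) (gen y) = gen y \<otimes>\<^bsub>\<G>\<^esub> c" if y: "y \<in> K" for y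
  proof -
    have g: "?i (gen y) \<in> sub A" by (rule Stv_apply_A[OF i gen_K_sub(2)[OF y]])
    then obtain c where c: "c \<in> sub C" "\<theta> (?i (gen y)) = ?i (gen y) \<otimes>\<^bsub>\<G>\<^esub> c"
      using Stv_s_apply_A[OF theta_s] by (metis (no_types))
    note gy = gen_K_carrier[OF y] and gc = sub_A_carrier[OF g]
    have "(\<phi> \<otimes>\<^bsub>\<A>\<^esub> \<theta> \<otimes>\<^bsub>\<A>\<^esub> ?i) (gen y) = \<phi> (\<theta> (?i (gen y)))"
      using a gy gc by (simp add: GG.AutoGroup_mult_apply GG.AutoGroup_mult_closed)
    also have "\<dots> = \<phi> (?i (gen y)) \<otimes>\<^bsub>\<G>\<^esub> \<phi> c"
      using GG.auto_mult[OF a(1) gc sub_C_carrier[OF c(1)]] c by simp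
    also have "\<dots> = gen y \<otimes>\<^bsub>\<G>\<^esub> c"
      using GG.AutoGroup_inv_apply(2)[OF a(1) gy] Stv_fixes_C[OF phi c(1)] by simp
    finally show ?thesis using c(1) by (rule bexI)
  qed
  then show ?thesis using Stv_mult[OF Stv_mult[OF phi theta] i] by (simp add: Stv_s_def)
qed

text \<open>If y c lies in \<open>sub U\<close>, then so does c, which
  \<open>sub_U_C_trivial\<close> makes trivial.\<close>

lemma Stv_l_Int_Stv_s: "Stv_l \<inter> Stv_s = {\<one>\<^bsub>\<A>\<^esub>}"
proof
  show "{\<one>\<^bsub>\<A>\<^esub>} \<subseteq> Stv_l \<inter> Stv_s"
    using subgroup.one_closed[OF subgroup_Stv_l] subgroup.one_closed[OF subgroup_Stv_s] by simp
  show "Stv_l \<inter> Stv_s \<subseteq> {\<one>\<^bsub>\<A>\<^esub>}"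
  proof
    fix \<phi> assume phi: "\<phi> \<in> Stv_l \<inter> Stv_s"
    then have phi_v: "\<phi> \<in> Stv \<Gamma> x" by (simp add: Stv_s_def)
    have "\<phi> (gen v) = gen v" if v: "v \<in> V" for v
    proof (cases "v \<in> K")
      case True
      obtain c where c: "c \<in> sub C" "\<phi> (gen v) = gen v \<otimes>\<^bsub>\<G>\<^esub> c" using Stv_sE phi True by auto
      have "\<phi> (gen v) \<in> sub U" using phi True by (simp add: Stv_l_def)
      then have "gen v \<otimes>\<^bsub>\<G>\<^esub> c \<in> sub U" by (simp only: c(2))
      then have "c \<in> sub U"
        using GG.mult_in_generate_iff[OF gen_image_carrier[OF U_subset]]
          gen_K_sub(1)[OF True] sub_C_carrier[OF c(1)] by (simp add: pc_sub_def)
      then show ?thesis using sub_U_C_trivial[OF _ c(1)] c(2) gen_K_carrier[OF True] by simp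
    qed (use v StvD(3)[OF phi_v] in simp)
    then have "\<phi> = \<one>\<^bsub>\<A>\<^esub>"
      by (intro pc_auto_eqI[OF StvD(1)[OF phi_v] GG.AutoGroup_one_closed])
        (simp add: GG.AutoGroup_one_apply gen_carrier)
    then show "\<phi> \<in> {\<one>\<^bsub>\<A>\<^esub>}" by simp
  qed
qed

section \<open>Construction of the maps y |-> y c_y\<close>

definition shift :: "('a \<Rightarrow> 'a gword set) \<Rightarrow> ('a gword set \<Rightarrow> 'a gword set) \<Rightarrow> bool" where
  "shift c \<sigma> \<longleftrightarrow> \<sigma> \<in> hom \<G> \<G> \<and>
    (\<forall>v\<in>V. \<sigma> (gen v) = (if v \<in> K then gen v \<otimes>\<^bsub>\<G>\<^esub> c v else gen v))"

lemma shift_exists: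
  assumes c: "\<And>y. y \<in> K \<Longrightarrow> c y \<in> sub C"
  shows "\<exists>\<sigma>. shift c \<sigma>"
proof -
  let ?f = "\<lambda>v. if v \<in> K then gen v \<otimes>\<^bsub>\<G>\<^esub> c v else gen v"
  have closed: "?f v \<in> carrier \<G>" if "v \<in> V" for v
    using that gen_carrier[of v] sub_C_carrier[OF c] by simp
  have comm1: "?f u \<otimes>\<^bsub>\<G>\<^esub> ?f v = ?f v \<otimes>\<^bsub>\<G>\<^esub> ?f u" if uv: "(u, v) \<in> parcs \<Gamma>" and u: "u \<in> K" for u v
  proof -
    have vV: "v \<in> V" using uv by (rule in_arcsD2)
    have v: "v \<in> lk \<Gamma> x" using uv lk_vclass[OF u] by (auto simp: lk_def)
    \<comment> \<open>\<open>K\<close> is an independent set: a neighbour of x with the same link as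
      x would be adjacent to itself.\<close>
    have vK: "v \<notin> K" using lk_vclass[of v] v arc_irrefl by (auto simp: lk_def)
    \<comment> \<open>Every vertex of \<open>C\<close> equals or is adjacent to v, because v is a
      neighbour of x.\<close>
    have "c u \<otimes>\<^bsub>\<G>\<^esub> gen v = gen v \<otimes>\<^bsub>\<G>\<^esub> c u"
      using C_arc_lk v vV by (intro sub_commute[OF C_subset, of "{v}"] c u gen_in_sub) auto
    moreover note gen_commute_arc[OF uv]
    moreover note car = gen_K_carrier[OF u] sub_C_carrier[OF c[OF u]] gen_carrier[OF vV]
    have "gen u \<otimes>\<^bsub>\<G>\<^esub> c u \<otimes>\<^bsub>\<G>\<^esub> gen v = gen u \<otimes>\<^bsub>\<G>\<^esub> (c u \<otimes>\<^bsub>\<G>\<^esub> gen v)"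
      using car by (simp add: GG.m_assoc)
    moreover have "gen u \<otimes>\<^bsub>\<G>\<^esub> (gen v \<otimes>\<^bsub>\<G>\<^esub> c u) = gen u \<otimes>\<^bsub>\<G>\<^esub> gen v \<otimes>\<^bsub>\<G>\<^esub> c u"
      using car by (simp add: GG.m_assoc)
    moreover have "gen v \<otimes>\<^bsub>\<G>\<^esub> gen u \<otimes>\<^bsub>\<G>\<^esub> c u = gen v \<otimes>\<^bsub>\<G>\<^esub> (gen u \<otimes>\<^bsub>\<G>\<^esub> c u)"
      using car by (simp add: GG.m_assoc)
    ultimately show ?thesis using u vK by simp
  qed
  have comm: "?f u \<otimes>\<^bsub>\<G>\<^esub> ?f v = ?f v \<otimes>\<^bsub>\<G>\<^esub> ?f u" if uv: "(u, v) \<in> parcs \<Gamma>" for u v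
  proof -
    consider "u \<in> K" | "v \<in> K" | "u \<notin> K" "v \<notin> K" by auto
    then show ?thesis
    proof cases
      case 1
      then show ?thesis by (rule comm1[OF uv])
    next
      case 2
      then show ?thesis by (rule comm1[OF arc_sym[OF uv], symmetric])
    next
      case 3
      then show ?thesis using gen_commute_arc[OF uv] by simp
    qed
  qed
  obtain \<sigma> where "\<sigma> \<in> hom \<G> \<G>" "\<And>v. v \<in> V \<Longrightarrow> \<sigma> (gen v) = ?f v"
    using pc_hom_exists[of \<G> ?f, OF GG.is_group closed comm] by metis
  then show ?thesis unfolding shift_def by (intro exI[of _ \<sigma>]) simp
qed

text \<open>\<sigma> fixes \<open>sub C\<close>, so it sends v d_v to v c_v d_v = v. Applied in both
  orders, this makes a shift bijective.\<close>

lemma shift_inverse: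
  assumes \<sigma>: "shift c \<sigma>" and \<tau>: "shift d \<tau>" and d: "\<And>y. y \<in> K \<Longrightarrow> d y \<in> sub C"
    and c: "\<And>y. y \<in> K \<Longrightarrow> c y \<in> sub C"
    and cd: "\<And>y. y \<in> K \<Longrightarrow> c y \<otimes>\<^bsub>\<G>\<^esub> d y = \<one>\<^bsub>\<G>\<^esub>" and g: "g \<in> carrier \<G>"
  shows "\<sigma> (\<tau> g) = g"
proof -
  have hom: "\<sigma> \<in> hom \<G> \<G>" "\<tau> \<in> hom \<G> \<G>" using \<sigma> \<tau> by (simp_all add: shift_def)
  have fix_C: "\<sigma> e = e" if "e \<in> sub C" for e
  proof (rule pc_hom_eqI[where \<psi> = "\<lambda>g. g", OF GG.is_group hom(1) _ C_subset _ that])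
    show "(\<lambda>g. g) \<in> hom \<G> \<G>" by (simp add: hom_def)
    show "\<sigma> (gen z) = gen z" if "z \<in> C" for z
      using \<sigma> that C_subset by (simp add: shift_def subset_iff)
  qed
  have "(\<sigma> \<circ> \<tau>) g = (\<lambda>g. g) g"
  proof (rule pc_hom_eqI[where \<psi> = "\<lambda>g. g", OF GG.is_group _ _ order.refl])
    show "\<sigma> \<circ> \<tau> \<in> hom \<G> \<G>" using hom by (intro hom_compose)
    show "(\<lambda>g. g) \<in> hom \<G> \<G>" by (simp add: hom_def)
    show "g \<in> sub V" using g carrier_eq_sub by simp
    fix v assume v: "v \<in> V"
    show "(\<sigma> \<circ> \<tau>) (gen v) = gen v"
    proof (cases "v \<in> K")
      case True
      note car = gen_K_carrier[OF True] sub_C_carrier[OF d[OF True]] sub_C_carrier[OF c[OF True]]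
      have "(\<sigma> \<circ> \<tau>) (gen v) = \<sigma> (gen v \<otimes>\<^bsub>\<G>\<^esub> d v)" using \<tau> v True by (simp add: shift_def)
      also have "\<dots> = gen v \<otimes>\<^bsub>\<G>\<^esub> c v \<otimes>\<^bsub>\<G>\<^esub> d v"
        using hom_mult[OF hom(1) car(1,2)] fix_C[OF d[OF True]] \<sigma> v True by (simp add: shift_def)
      also have "\<dots> = gen v" using car cd[OF True] by (simp add: GG.m_assoc)
      finally show ?thesis .
    qed (use \<sigma> \<tau> v in \<open>simp add: shift_def\<close>)
  qed
  then show ?thesis by simp
qed

text \<open>By \<open>C_subset_adm\<close>, an admissible set containing v in \<open>K\<close> also
  contains \<open>C\<close>, and so c_v is available there. The reverse inclusion will come from the
  shift by the inverses.\<close>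

lemma shift_sub_adm:
  assumes \<sigma>: "shift c \<sigma>" and c: "\<And>y. y \<in> K \<Longrightarrow> c y \<in> sub C"
  shows "\<sigma> ` sub (adm \<Gamma> u) \<subseteq> sub (adm \<Gamma> u)"
proof -
  have Y: "adm \<Gamma> u \<subseteq> V" by (auto simp: adm_def)
  have "group_hom \<G> \<G> \<sigma>"
    using \<sigma> GG.is_group by (simp add: shift_def group_hom_def group_hom_axioms_def)
  moreover have "\<sigma> (gen v) \<in> sub (adm \<Gamma> u)" if v: "v \<in> adm \<Gamma> u" for v
  proof (cases "v \<in> K")
    case True
    have "c v \<in> sub (adm \<Gamma> u)"
      using sub_mono[OF C_subset_adm[OF True v]] c[OF True] by (rule subsetD)
    then show ?thesis
      using \<sigma> True v Y subgroup.m_closed[OF subgroup_sub[OF Y] gen_in_sub[OF v]]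
      by (simp add: shift_def subset_iff)
  qed (use \<sigma> v Y gen_in_sub[OF v] in \<open>simp add: shift_def subset_iff\<close>)
  ultimately have "\<sigma> ` generate \<G> (gen ` adm \<Gamma> u) \<subseteq> sub (adm \<Gamma> u)"
    using gen_image_carrier[OF Y] subgroup_sub[OF Y]
    by (intro group_hom.generate_image_subset) (simp_all add: image_subset_iff)
  then show ?thesis by (simp add: pc_sub_def)
qed

lemma Stv_s_exists:
  assumes c: "\<And>y. y \<in> K \<Longrightarrow> c y \<in> sub C"
  shows "\<exists>\<sigma> \<in> Stv_s. \<forall>y \<in> K. \<sigma> (gen y) = gen y \<otimes>\<^bsub>\<G>\<^esub> c y"
proof -
  let ?d = "\<lambda>y. inv\<^bsub>\<G>\<^esub> c y"
  have d: "?d y \<in> sub C" if "y \<in> K" for y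
    using subgroup.m_inv_closed[OF subgroup_C c[OF that]] .
  obtain \<sigma> where \<sigma>: "shift c \<sigma>" using shift_exists[of c] c by auto
  obtain \<tau> where \<tau>: "shift ?d \<tau>" using shift_exists[of ?d] d by auto
  have hom: "\<sigma> \<in> hom \<G> \<G>" "\<tau> \<in> hom \<G> \<G>" using \<sigma> \<tau> by (simp_all add: shift_def)
  have st: "\<sigma> (\<tau> g) = g" if "g \<in> carrier \<G>" for g
    using sub_C_carrier[OF c] by (intro shift_inverse[OF \<sigma> \<tau> d c _ that]) simp_all
  have ts: "\<tau> (\<sigma> g) = g" if "g \<in> carrier \<G>" for g
    using sub_C_carrier[OF c] by (intro shift_inverse[OF \<tau> \<sigma> c d _ that]) simp_all
  \<comment> \<open>\<open>auto\<close> asks for extensional functions, while \<sigma> is arbitrary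
    outside the carrier.\<close>
  let ?\<sigma> = "restrict \<sigma> (carrier \<G>)"
  have "bij_betw ?\<sigma> (carrier \<G>) (carrier \<G>)"
    using st ts hom_in_carrier[OF hom(1)] hom_in_carrier[OF hom(2)]
    by (intro bij_betw_byWitness[where f' = \<tau>]) (simp_all add: image_subset_iff)
  moreover have "?\<sigma> \<in> hom \<G> \<G>"
    using hom(1) by (simp add: hom_def Pi_iff)
  ultimately have auto: "?\<sigma> \<in> auto \<G>" by (simp add: auto_def Bij_def)
  have "?\<sigma> ` sub Y = sub Y" if "Y \<in> adm_sets \<Gamma>" for Y
  proof -
    obtain u where u: "Y = adm \<Gamma> u" using \<open>Y \<in> adm_sets \<Gamma>\<close> by (auto simp: adm_sets_def)
    have Y: "Y \<subseteq> V" by (auto simp: u adm_def)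
    have 1: "\<sigma> ` sub Y \<subseteq> sub Y" "\<tau> ` sub Y \<subseteq> sub Y"
      using shift_sub_adm[OF \<sigma> c] shift_sub_adm[OF \<tau> d] by (simp_all add: u)
    \<comment> \<open>Since \<tau> preserves \<open>sub Y\<close> as well, each of its elements is
      the image under \<sigma> of another one.\<close>
    have "sub Y = \<sigma> ` (\<tau> ` sub Y)"
      using st subsetD[OF sub_subset_carrier[OF Y]] by (simp add: image_image)
    also have "\<dots> \<subseteq> \<sigma> ` sub Y" by (rule image_mono[OF 1(2)])
    finally have "\<sigma> ` sub Y = sub Y" using 1(1) by (intro equalityI)
    then show ?thesis using subsetD[OF sub_subset_carrier[OF Y]] by (simp cong: image_cong)
  qed
  then have Stv: "?\<sigma> \<in> Stv \<Gamma> x"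
    using auto \<sigma> gen_carrier by (simp add: Stv_def StK_def shift_def)
  have eq: "?\<sigma> (gen y) = gen y \<otimes>\<^bsub>\<G>\<^esub> c y" if "y \<in> K" for y
    using \<sigma> that K_subset gen_carrier by (simp add: shift_def subset_iff)
  have "?\<sigma> \<in> Stv_s" using Stv eq c by (simp add: Stv_s_def) (metis (no_types))
  then show ?thesis using eq by (intro bexI[of _ ?\<sigma>]) simp_all
qed

section \<open>Factorization and the semidirect product\<close>

lemma Stv_factorization:
  assumes phi: "\<phi> \<in> Stv \<Gamma> x"
  shows "\<exists>\<psi> \<in> Stv_l. \<exists>\<sigma> \<in> Stv_s. \<phi> = \<psi> \<otimes>\<^bsub>\<A>\<^esub> \<sigma>"
proof -
  have "\<exists>l c. l \<in> sub U \<and> c \<in> sub C \<and> \<phi> (gen y) = l \<otimes>\<^bsub>\<G>\<^esub> c" if y: "y \<in> K" for y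
    using sub_A_split[OF Stv_apply_A[OF phi gen_K_sub(2)[OF y]]] by metis
  then obtain l c where lc: "\<And>y. y \<in> K \<Longrightarrow> l y \<in> sub U" "\<And>y. y \<in> K \<Longrightarrow> c y \<in> sub C"
    "\<And>y. y \<in> K \<Longrightarrow> \<phi> (gen y) = l y \<otimes>\<^bsub>\<G>\<^esub> c y"
    by metis
  obtain \<sigma> where \<sigma>: "\<sigma> \<in> Stv_s" "\<And>y. y \<in> K \<Longrightarrow> \<sigma> (gen y) = gen y \<otimes>\<^bsub>\<G>\<^esub> c y"
    using Stv_s_exists[of c, OF lc(2)] by auto
  then have \<sigma>': "\<sigma> \<in> Stv \<Gamma> x" by (simp add: Stv_s_def)
  let ?i = "inv\<^bsub>\<A>\<^esub> \<sigma>" and ?l = "\<phi> \<otimes>\<^bsub>\<A>\<^esub> inv\<^bsub>\<A>\<^esub> \<sigma>"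
  have i: "?i \<in> Stv \<Gamma> x" by (rule Stv_inv[OF \<sigma>'])
  note a = StvD(1)[OF phi] StvD(1)[OF \<sigma>'] StvD(1)[OF i]
  have "?l (gen y) = l y" if y: "y \<in> K" for y
  proof -
    note car = gen_K_carrier[OF y] sub_C_carrier[OF lc(2)[OF y]] sub_U_carrier[OF lc(1)[OF y]]
    have l: "?l \<in> Stv \<Gamma> x" by (rule Stv_mult[OF phi i])
    \<comment> \<open>\<open>?l\<close> is evaluated at \<sigma> y = y c_y in two ways: the value is
      \<phi> y = l_y c_y, and \<open>?l\<close> fixes c_y. Cancelling c_y shows that
      \<open>?l\<close> sends y to l_y.\<close>
    have "l y \<otimes>\<^bsub>\<G>\<^esub> c y = \<phi> (?i (\<sigma> (gen y)))"
      using lc(3)[OF y] GG.AutoGroup_inv_apply(1)[OF a(2) car(1)] by simp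
    also have "\<dots> = ?l (\<sigma> (gen y))"
      using GG.AutoGroup_mult_apply[OF a(1,3) GG.auto_in_carrier[OF a(2) car(1)]] by simp
    also have "\<dots> = ?l (gen y) \<otimes>\<^bsub>\<G>\<^esub> c y"
      using GG.auto_mult[OF StvD(1)[OF l] car(1,2)] \<sigma>(2)[OF y] Stv_fixes_C[OF l lc(2)[OF y]] by simp
    finally show ?thesis
      using car GG.auto_in_carrier[OF StvD(1)[OF l] car(1)] GG.right_cancel by simp
  qed
  then have "?l \<in> Stv_l" using Stv_mult[OF phi i] lc(1) by (simp add: Stv_l_def)
  moreover have "\<phi> = ?l \<otimes>\<^bsub>\<A>\<^esub> \<sigma>"
  proof -
    interpret AA: group \<A> by (rule GG.AutoGroup)
    show ?thesis using a by (simp add: AA.m_assoc)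
  qed
  ultimately show ?thesis using \<sigma>(1) by (intro bexI)
qed

lemma group_Stv_group: "group (Stv_group \<Gamma> x)"
  unfolding Stv_group_def by (rule subgroup.subgroup_is_group[OF subgroup_Stv GG.AutoGroup])

lemma subgroup_Stv_group:
  "subgroup H \<A> \<Longrightarrow> H \<subseteq> Stv \<Gamma> x \<Longrightarrow> subgroup H (Stv_group \<Gamma> x)"
  unfolding Stv_group_def by (rule group.subgroup_incl[OF GG.AutoGroup _ subgroup_Stv])

lemma Stv_semidirect: "internal_semidirect (Stv_group \<Gamma> x) Stv_l Stv_s"
  unfolding internal_semidirect_def
proof (intro conjI)
  have mult: "f \<otimes>\<^bsub>Stv_group \<Gamma> x\<^esub> g = f \<otimes>\<^bsub>\<A>\<^esub> g" for f g by (simp add: Stv_group_def)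
  have inv: "inv\<^bsub>Stv_group \<Gamma> x\<^esub> f = inv\<^bsub>\<A>\<^esub> f" if "f \<in> Stv \<Gamma> x" for f
    unfolding Stv_group_def by (rule group.m_inv_consistent[OF GG.AutoGroup subgroup_Stv that])
  have carrier: "carrier (Stv_group \<Gamma> x) = Stv \<Gamma> x" by (simp add: Stv_group_def)
  show "subgroup Stv_l (Stv_group \<Gamma> x)"
    by (rule subgroup_Stv_group[OF subgroup_Stv_l]) (auto simp: Stv_l_def)
  show "Stv_s \<lhd> Stv_group \<Gamma> x"
    unfolding group.normal_inv_iff[OF group_Stv_group] carrier
    using Stv_s_conjugate subgroup_Stv_group[OF subgroup_Stv_s]
    by (auto simp: mult inv Stv_s_def)
  show "Stv_l \<inter> Stv_s = {\<one>\<^bsub>Stv_group \<Gamma> x\<^esub>}"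
    using Stv_l_Int_Stv_s by (simp add: Stv_group_def)
  show "Stv_l <#>\<^bsub>Stv_group \<Gamma> x\<^esub> Stv_s = carrier (Stv_group \<Gamma> x)"
    using Stv_factorization Stv_mult by (auto simp: set_mult_def mult carrier Stv_l_def Stv_s_def)
qed

section \<open>Identification of the normal factor with integer matrices\<close>

lemma Stv_s_expo:
  assumes "\<phi> \<in> Stv_s" "y \<in> K" "z \<in> C" "c \<in> sub C" "\<phi> (gen y) = gen y \<otimes>\<^bsub>\<G>\<^esub> c"
  shows "expo z (\<phi> (gen y)) = expo z c"
proof -
  have "y \<noteq> z" "y \<in> V" using assms(2,3) K_subset by auto
  then show ?thesis
    using assms(5) expo_mult[OF gen_K_carrier[OF assms(2)] sub_C_carrier[OF assms(4)]] expo(2)[of y z]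
    by simp
qed

text \<open>If the maps multiply y by c and d, then c d^-1 lies in \<open>sub C\<close> with all
  exponents 0, hence c = d.\<close>

lemma Stv_s_eqI:
  assumes phi: "\<phi> \<in> Stv_s" and psi: "\<psi> \<in> Stv_s"
    and eq: "\<And>y z. y \<in> K \<Longrightarrow> z \<in> C \<Longrightarrow> expo z (\<phi> (gen y)) = expo z (\<psi> (gen y))"
  shows "\<phi> = \<psi>"
proof -
  have Stv: "\<phi> \<in> Stv \<Gamma> x" "\<psi> \<in> Stv \<Gamma> x" using phi psi by (simp_all add: Stv_s_def)
  show ?thesis
  proof (rule pc_auto_eqI[OF StvD(1)[OF Stv(1)] StvD(1)[OF Stv(2)]])
    fix v assume v: "v \<in> V"
    show "\<phi> (gen v) = \<psi> (gen v)"
    proof (cases "v \<in> K")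
      case True
      obtain c where c: "c \<in> sub C" "\<phi> (gen v) = gen v \<otimes>\<^bsub>\<G>\<^esub> c" by (rule Stv_sE[OF phi True])
      obtain d where d: "d \<in> sub C" "\<psi> (gen v) = gen v \<otimes>\<^bsub>\<G>\<^esub> d" by (rule Stv_sE[OF psi True])
      note car = sub_C_carrier[OF c(1)] sub_C_carrier[OF d(1)]
      have "c \<otimes>\<^bsub>\<G>\<^esub> inv\<^bsub>\<G>\<^esub> d = \<one>\<^bsub>\<G>\<^esub>"
      proof (rule clique_sub_trivial[OF _ C_subset C_clique])
        show "finite C" using finite_subset[OF C_subset finite_verts] .
        show "c \<otimes>\<^bsub>\<G>\<^esub> inv\<^bsub>\<G>\<^esub> d \<in> sub C"
          by (intro subgroup.m_closed[OF subgroup_C] subgroup.m_inv_closed[OF subgroup_C] c d)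
        show "expo z (c \<otimes>\<^bsub>\<G>\<^esub> inv\<^bsub>\<G>\<^esub> d) = 0" if z: "z \<in> C" for z
          using Stv_s_expo[OF phi True z c] Stv_s_expo[OF psi True z d] eq[OF True z] car
          by (simp add: expo_mult expo_inv)
      qed
      then have "inv\<^bsub>\<G>\<^esub> (inv\<^bsub>\<G>\<^esub> d) = c" using car by (intro GG.inv_equality) simp_all
      then have "c = d" using car by simp
      then show ?thesis using c d by simp
    qed (use v StvD(3)[OF Stv(1)] StvD(3)[OF Stv(2)] in simp)
  qed
qed

lemma Stv_s_iso_mat:
  "(Stv_group \<Gamma> x)\<lparr>carrier := Stv_s\<rparr> \<cong> add_monoid (module_mat TYPE(int) (card K) (card C))"
    (is "?S \<cong> ?M")
proof -
  have fin: "finite K" "finite C"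
    using finite_subset[OF K_subset finite_verts] finite_subset[OF C_subset finite_verts] .
  \<comment> \<open>The enumerations turn vertices of \<open>K\<close> and \<open>C\<close> into row
    and column indices; the isomorphism \<open>h\<close> depends on them.\<close>
  obtain ys where ys: "bij_betw ys {0..<card K} K" using ex_bij_betw_nat_finite[OF fin(1)] by auto
  obtain zs where zs: "bij_betw zs {0..<card C} C" using ex_bij_betw_nat_finite[OF fin(2)] by auto
  have ysK: "ys i \<in> K" if "i < card K" for i using bij_betwE[OF ys] that by simp
  have zsC: "zs j \<in> C" if "j < card C" for j using bij_betwE[OF zs] that by simp
  define h where "h \<phi> = mat (card K) (card C) (\<lambda>(i, j). expo (zs j) (\<phi> (gen (ys i))))"
    for \<phi> :: "'a gword set \<Rightarrow> 'a gword set"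
  have M: "carrier ?M = carrier_mat (card K) (card C)" "monoid.mult ?M = (+)"
    by (simp_all add: module_mat_simps)
  have S: "carrier ?S = Stv_s" "monoid.mult ?S = monoid.mult \<A>"
    by (simp_all add: Stv_group_def)
  have "h \<in> hom ?S ?M"
  proof (rule homI)
    fix \<phi> assume phi: "\<phi> \<in> carrier ?S"
    show "h \<phi> \<in> carrier ?M" by (simp add: module_mat_simps h_def)
    fix \<psi> assume psi: "\<psi> \<in> carrier ?S"
    have prod: "\<phi> \<otimes>\<^bsub>\<A>\<^esub> \<psi> \<in> Stv_s"
      using phi psi by (simp add: S subgroup.m_closed[OF subgroup_Stv_s])
    have "expo z ((\<phi> \<otimes>\<^bsub>\<A>\<^esub> \<psi>) (gen y)) = expo z (\<phi> (gen y)) + expo z (\<psi> (gen y))"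
      if y: "y \<in> K" and z: "z \<in> C" for y z
    proof -
      have phi: "\<phi> \<in> Stv_s" and psi: "\<psi> \<in> Stv_s" using phi psi by (simp_all add: S)
      obtain c where c: "c \<in> sub C" "\<phi> (gen y) = gen y \<otimes>\<^bsub>\<G>\<^esub> c" by (rule Stv_sE[OF phi y])
      obtain d where d: "d \<in> sub C" "\<psi> (gen y) = gen y \<otimes>\<^bsub>\<G>\<^esub> d" by (rule Stv_sE[OF psi y])
      have "expo z ((\<phi> \<otimes>\<^bsub>\<A>\<^esub> \<psi>) (gen y)) = expo z (c \<otimes>\<^bsub>\<G>\<^esub> d)"
        using Stv_s_expo[OF prod y z subgroup.m_closed[OF subgroup_C c(1) d(1)]
          Stv_s_mult_gen[OF phi psi y c d]] .
      then show ?thesis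
        using expo_mult[OF sub_C_carrier[OF c(1)] sub_C_carrier[OF d(1)]]
          Stv_s_expo[OF phi y z c] Stv_s_expo[OF psi y z d] by simp
    qed
    then show "h (\<phi> \<otimes>\<^bsub>?S\<^esub> \<psi>) = h \<phi> \<otimes>\<^bsub>?M\<^esub> h \<psi>"
      unfolding S M using ysK zsC by (intro eq_matI) (simp_all add: h_def)
  qed
  moreover have "inj_on h Stv_s"
  proof (rule inj_onI)
    fix \<phi> \<psi> assume phi: "\<phi> \<in> Stv_s" and psi: "\<psi> \<in> Stv_s" and eq: "h \<phi> = h \<psi>"
    show "\<phi> = \<psi>"
    proof (rule Stv_s_eqI[OF phi psi])
      fix y z assume "y \<in> K" "z \<in> C"
      then have "y \<in> ys ` {0..<card K}" "z \<in> zs ` {0..<card C}"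
        using bij_betw_imp_surj_on[OF ys] bij_betw_imp_surj_on[OF zs] by simp_all
      then obtain i j where ij: "i < card K" "y = ys i" "j < card C" "z = zs j" by auto
      have "h \<phi> $$ (i, j) = h \<psi> $$ (i, j)" using eq by simp
      then show "expo z (\<phi> (gen y)) = expo z (\<psi> (gen y))" using ij by (simp add: h_def)
    qed
  qed
  moreover have "carrier ?M \<subseteq> h ` Stv_s"
  proof
    fix m assume "m \<in> carrier ?M"
    then have m: "m \<in> carrier_mat (card K) (card C)" by (simp add: module_mat_simps)
    \<comment> \<open>The prescribed exponents: the entry of \<open>m\<close> in the row of y and
      the column of z. Stating existence for every y of the type lets \<open>choice\<close> produce
      a total function.\<close>
    let ?n = "\<lambda>y z. m $$ (inv_into {0..<card K} ys y, inv_into {0..<card C} zs z)"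
    have "\<forall>y. \<exists>c. c \<in> sub C \<and> (\<forall>z \<in> C. expo z c = ?n y z)"
      using sub_expo_exists[OF fin(2) C_subset] unfolding Bex_def by (intro allI)
    from choice[OF this] obtain c where "\<forall>y. c y \<in> sub C \<and> (\<forall>z \<in> C. expo z (c y) = ?n y z)"
      by (elim exE)
    then have c: "\<And>y. c y \<in> sub C" "\<And>y z. z \<in> C \<Longrightarrow> expo z (c y) = ?n y z"
      by simp_all
    obtain \<sigma> where \<sigma>: "\<sigma> \<in> Stv_s" "\<And>y. y \<in> K \<Longrightarrow> \<sigma> (gen y) = gen y \<otimes>\<^bsub>\<G>\<^esub> c y"
      using Stv_s_exists[of c] c(1) by auto
    have "h \<sigma> = m"
    proof (rule eq_matI)
      fix i j assume "i < dim_row m" "j < dim_col m"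
      then have ij: "i < card K" "j < card C" using m by auto
      have "inv_into {0..<card K} ys (ys i) = i" "inv_into {0..<card C} zs (zs j) = j"
        using ij bij_betw_inv_into_left[OF ys] bij_betw_inv_into_left[OF zs] by simp_all
      then show "h \<sigma> $$ (i, j) = m $$ (i, j)"
        using ij Stv_s_expo[OF \<sigma>(1) ysK zsC c(1) \<sigma>(2)] ysK zsC c(2) by (simp add: h_def)
    qed (use m in \<open>auto simp: h_def\<close>)
    then show "m \<in> h ` Stv_s" using \<sigma>(1) by auto
  qed
  moreover have "h ` Stv_s \<subseteq> carrier ?M"
    by (auto simp: module_mat_simps h_def)
  ultimately show ?thesis
    by (intro is_isoI[of h]) (simp add: iso_iff S(1) subset_antisym)
qed

end

theorem theorem1p3:
  fixes \<Gamma> :: "'a pair_pre_digraph" and x :: 'a and p q :: nat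
  assumes "pair_graph \<Gamma>"
    and "x \<in> pverts \<Gamma>"
    and "adm \<Gamma> x \<noteq> cl \<Gamma> x"
    and "q = card (cl \<Gamma> x \<union> vclass \<Gamma> x)"
    and "p = card (vclass \<Gamma> x)"
  shows "p \<le> q \<and>
    (\<exists>L S. subgroup L (Stv_group \<Gamma> x) \<and> subgroup S (Stv_group \<Gamma> x) \<and>
      internal_semidirect (Stv_group \<Gamma> x) L S \<and>
      L = {\<phi> \<in> Stv \<Gamma> x.
             \<forall>y \<in> vclass \<Gamma> x. \<phi> (pc_gen \<Gamma> y) \<in> pc_sub \<Gamma> (vclass \<Gamma> x \<union> adm_out \<Gamma> x)} \<and>
      (Stv_group \<Gamma> x)\<lparr>carrier := S\<rparr> \<cong> add_monoid (module_mat TYPE(int) p (q - p)))"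
proof -
  interpret raag_vertex \<Gamma> x by (intro raag_vertex.intro raag.intro raag_vertex_axioms.intro assms)
  have fin: "finite (cl \<Gamma> x \<union> K)"
    using K_subset_A A_subset cl_eq by (intro finite_subset[OF _ finite_verts]) auto
  have "p \<le> q" unfolding assms(4,5) using fin by (intro card_mono) auto
  moreover have "card C = q - p"
  proof -
    have "C = (cl \<Gamma> x \<union> K) - K" by auto
    then show ?thesis using fin by (simp add: assms(4,5) card_Diff_subset)
  qed
  moreover have "Stv_l = {\<phi> \<in> Stv \<Gamma> x. \<forall>y \<in> K. \<phi> (gen y) \<in> sub U}" by (rule Stv_l_def)
  ultimately show ?thesis
    using Stv_semidirect Stv_s_iso_mat assms(5) subgroup_Stv_group[OF subgroup_Stv_s]
    by (intro conjI exI[of _ Stv_l] exI[of _ Stv_s])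
      (auto simp: internal_semidirect_def Stv_s_def)
qed

end
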